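(* Let $\mathcal{O}$ be an open set of a smooth manifold, let $X$ be a continuous vector field on $\mathcal{O}$, and let $\mu$ be a nonnegative density measure on $\mathcal{O}$ that is a solution to ${}^{t}X\mu=0$ in the sense of distributions. Then the support of $\mu$ is a union of maximally extended integral curves of the vector field $X$. In other words, if $m^0\in\mathcal{O}$ is in $\operatorname{supp}(\mu)$, then there exist an interval $I$ in $\mathbb{R}$ with $0\in I$ and a $C^1$ curve $\gamma: I\to\mathcal{O}$ that cannot be extended (as an integral curve of $X$ in $\mathcal{O}$) such that $\gamma(0)=m^0$, $\frac{d}{ds}\gamma(s)=X(\gamma(s))$ for all $s\in I$, and $\gamma(I)\subset\operatorname{supp}(\mu)$.
   Context: A density measure on $\mathcal{O}$ is a density Radon measure (it pairs with functions $a\in C^0_c(\mathcal{O})$, the pairing being denoted $\langle\mu,a\rangle$). The equation ${}^{t}X\mu=0$ in the sense of distributions means $\langle \mu, Xa\rangle=0$ for all $a\in C^\infty_c(\mathcal{O})$, where $Xa$ is the derivative of $a$ along $X$ (a continuous compactly supported function). Since $X$ is only continuous, integral curves exist but need not be unique. *)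

theory Defs
  imports "HOL-Analysis.Analysis"
begin

section \<open>Smooth functions on open subsets of Euclidean space\<close>

text \<open>For open S: k-fold continuous differentiability, respectively smoothness. Since the
  domain is finite dimensional, continuity of all iterated directional derivatives is the usual
  notion.\<close>

primrec Ck_on :: "nat \<Rightarrow> 'e::euclidean_space set \<Rightarrow> ('e \<Rightarrow> 'f::real_normed_vector) \<Rightarrow> bool" where
  "Ck_on 0 S f \<longleftrightarrow> continuous_on S f"
| "Ck_on (Suc k) S f \<longleftrightarrow>
     (\<forall>x\<in>S. f differentiable (at x)) \<and> (\<forall>v. Ck_on k S (\<lambda>x. frechet_derivative f (at x) v))"

definition smooth_on :: "'e::euclidean_space set \<Rightarrow> ('e \<Rightarrow> 'f::real_normed_vector) \<Rightarrow> bool" where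
  "smooth_on S f \<longleftrightarrow> (\<forall>k. Ck_on k S f)"


section \<open>Smooth manifolds\<close>

text \<open>The manifold is the whole type \<open>'a\<close>; it is Hausdorff and second countable by its sort.
  The value of the coordinate map outside the domain of the chart is irrelevant.\<close>

record ('a, 'e) chart =
  chart_dom :: "'a set"
  coords :: "'a \<Rightarrow> 'e"

definition param :: "('a, 'e) chart \<Rightarrow> 'e \<Rightarrow> 'a" where
  "param c = inv_into (chart_dom c) (coords c)"

definition is_chart ::
    "('a::{t2_space,second_countable_topology}, 'e::euclidean_space) chart \<Rightarrow> bool" where
  "is_chart c \<longleftrightarrow> open (chart_dom c) \<and> open (coords c ` chart_dom c) \<and>
     homeomorphism (chart_dom c) (coords c ` chart_dom c) (coords c) (param c)"

definition smooth_atlas ::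
    "('a::{t2_space,second_countable_topology}, 'e::euclidean_space) chart set \<Rightarrow> bool" where
  "smooth_atlas A \<longleftrightarrow>
     (\<forall>c\<in>A. is_chart c) \<and> (\<Union>c\<in>A. chart_dom c) = UNIV \<and>
     (\<forall>c\<in>A. \<forall>d\<in>A. smooth_on (coords c ` (chart_dom c \<inter> chart_dom d)) (coords d \<circ> param c))"


section \<open>Vector fields\<close>

text \<open>A tangent vector at m is given by its coordinate vectors \<open>v c\<close> in all charts c
  around m, related by the differentials of the transition maps (that is, by all the
  representatives of a class of pairs of a chart and a vector). Values \<open>v c\<close> for charts c
  not containing m are irrelevant.\<close>

definition tangent_vector ::
    "('a::{t2_space,second_countable_topology}, 'e::euclidean_space) chart set \<Rightarrow> 'a \<Rightarrow>
     (('a, 'e) chart \<Rightarrow> 'e) \<Rightarrow> bool" where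
  "tangent_vector A m v \<longleftrightarrow>
     (\<forall>c\<in>A. \<forall>d\<in>A. m \<in> chart_dom c \<longrightarrow> m \<in> chart_dom d \<longrightarrow>
        v d = frechet_derivative (coords d \<circ> param c) (at (coords c m)) (v c))"

definition continuous_vector_field ::
    "('a::{t2_space,second_countable_topology}, 'e::euclidean_space) chart set \<Rightarrow> 'a set \<Rightarrow>
     ('a \<Rightarrow> ('a, 'e) chart \<Rightarrow> 'e) \<Rightarrow> bool" where
  "continuous_vector_field A U X \<longleftrightarrow>
     (\<forall>m\<in>U. tangent_vector A m (X m)) \<and>
     (\<forall>c\<in>A. continuous_on (U \<inter> chart_dom c) (\<lambda>m. X m c))"

text \<open>Derivative of a function along a vector field. By the chain rule it does not depend
  on the chosen chart when f is differentiable at m and \<open>X m\<close> is a tangent vector.\<close>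

definition derivative_along ::
    "('a::{t2_space,second_countable_topology}, 'e::euclidean_space) chart set \<Rightarrow>
     ('a \<Rightarrow> ('a, 'e) chart \<Rightarrow> 'e) \<Rightarrow> ('a \<Rightarrow> real) \<Rightarrow> 'a \<Rightarrow> real" where
  "derivative_along A X f m =
     (let c = SOME c. c \<in> A \<and> m \<in> chart_dom c
      in frechet_derivative (f \<circ> param c) (at (coords c m)) (X m c))"


section \<open>Density measures\<close>

text \<open>Smooth functions with compact support in the open set U, extended by zero to the whole
  manifold.\<close>

definition test_function ::
    "('a::{t2_space,second_countable_topology}, 'e::euclidean_space) chart set \<Rightarrow> 'a set \<Rightarrow>
     ('a \<Rightarrow> real) \<Rightarrow> bool" where
  "test_function A U f \<longleftrightarrow>
     (\<forall>c\<in>A. smooth_on (coords c ` (U \<inter> chart_dom c)) (f \<circ> param c)) \<and>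
     compact (closure {m. f m \<noteq> 0}) \<and> closure {m. f m \<noteq> 0} \<subseteq> U"

text \<open>A density measure pairs with functions, not with densities, so a nonnegative density
  measure on U is a Radon measure on U; the pairing with f is the integral of f.\<close>

definition nonneg_density_measure :: "'a::topological_space set \<Rightarrow> 'a measure \<Rightarrow> bool" where
  "nonneg_density_measure U \<mu> \<longleftrightarrow>
     sets \<mu> = sets (restrict_space borel U) \<and>
     (\<forall>K. compact K \<and> K \<subseteq> U \<longrightarrow> emeasure \<mu> K < \<infinity>) \<and>
     (\<forall>B\<in>sets \<mu>. emeasure \<mu> B = (SUP K\<in>{K. compact K \<and> K \<subseteq> B}. emeasure \<mu> K))"

definition measure_supp :: "'a::topological_space set \<Rightarrow> 'a measure \<Rightarrow> 'a set" where
  "measure_supp U \<mu> = U - \<Union>{V. open V \<and> V \<subseteq> U \<and> emeasure \<mu> V = 0}"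

text \<open>The equation \<open>\<^sup>tX \<mu> = 0\<close> on U in the sense of distributions.\<close>

definition transpose_annihilates ::
    "('a::{t2_space,second_countable_topology}, 'e::euclidean_space) chart set \<Rightarrow> 'a set \<Rightarrow>
     ('a \<Rightarrow> ('a, 'e) chart \<Rightarrow> 'e) \<Rightarrow> 'a measure \<Rightarrow> bool" where
  "transpose_annihilates A U X \<mu> \<longleftrightarrow>
     (\<forall>f. test_function A U f \<longrightarrow> (\<integral>m. derivative_along A X f m \<partial>\<mu>) = 0)"


section \<open>Integral curves\<close>

text \<open>The derivative is one-sided at an endpoint of the interval I that belongs to I.\<close>

definition has_velocity ::
    "('a::{t2_space,second_countable_topology}, 'e::euclidean_space) chart set \<Rightarrow> real set \<Rightarrow>
     (real \<Rightarrow> 'a) \<Rightarrow> real \<Rightarrow> (('a, 'e) chart \<Rightarrow> 'e) \<Rightarrow> bool" where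
  "has_velocity A I \<gamma> s v \<longleftrightarrow>
     (\<forall>c\<in>A. \<gamma> s \<in> chart_dom c \<longrightarrow>
        ((\<lambda>t. coords c (\<gamma> t)) has_vector_derivative v c) (at s within I))"

definition C1_curve ::
    "('a::{t2_space,second_countable_topology}, 'e::euclidean_space) chart set \<Rightarrow> real set \<Rightarrow>
     (real \<Rightarrow> 'a) \<Rightarrow> bool" where
  "C1_curve A I \<gamma> \<longleftrightarrow>
     continuous_on I \<gamma> \<and>
     (\<exists>v. (\<forall>s\<in>I. has_velocity A I \<gamma> s (v s)) \<and>
          (\<forall>c\<in>A. continuous_on {s\<in>I. \<gamma> s \<in> chart_dom c} (\<lambda>s. v s c)))"

definition integral_curve ::
    "('a::{t2_space,second_countable_topology}, 'e::euclidean_space) chart set \<Rightarrow> 'a set \<Rightarrow>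
     ('a \<Rightarrow> ('a, 'e) chart \<Rightarrow> 'e) \<Rightarrow> real set \<Rightarrow> (real \<Rightarrow> 'a) \<Rightarrow> bool" where
  "integral_curve A U X I \<gamma> \<longleftrightarrow>
     is_interval I \<and> I \<noteq> {} \<and> C1_curve A I \<gamma> \<and> \<gamma> ` I \<subseteq> U \<and>
     (\<forall>s\<in>I. has_velocity A I \<gamma> s (X (\<gamma> s)))"

definition maximal_integral_curve ::
    "('a::{t2_space,second_countable_topology}, 'e::euclidean_space) chart set \<Rightarrow> 'a set \<Rightarrow>
     ('a \<Rightarrow> ('a, 'e) chart \<Rightarrow> 'e) \<Rightarrow> real set \<Rightarrow> (real \<Rightarrow> 'a) \<Rightarrow> bool" where
  "maximal_integral_curve A U X I \<gamma> \<longleftrightarrow>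
     integral_curve A U X I \<gamma> \<and>
     \<not> (\<exists>J \<delta>. integral_curve A U X J \<delta> \<and> I \<subset> J \<and> (\<forall>s\<in>I. \<delta> s = \<gamma> s))"

end

theory Submission
  imports Defs
begin

text \<open>Let \<open>x\<close> be a point of the support, in a chart. If no point of the support were within
  \<open>\<epsilon> h\<close> of \<open>x + h X(x)\<close>, one could test the equation against a function that is positive in a thin
  paraboloid around the segment from \<open>x\<close> to \<open>x + h X(x)\<close> and increases along \<open>X\<close> except in the ball of
  radius \<open>\<epsilon> h\<close> around the endpoint. Its derivative along \<open>X\<close> would be nonnegative on the support and
  positive at \<open>x\<close>, contradicting the vanishing of its integral. Hence Euler steps can be taken inside
  the support, uniformly on compact sets, and in the limit (Nagumo's viability theorem) they give an
  integral curve inside the support. The same holds for \<open>- X\<close>, which gives the curve for negative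
  times. Zorn's lemma yields a curve that is maximal among those in the support.\<close>

section \<open>Smooth functions\<close>

text \<open>As \<open>X\<close> is merely continuous, there is no flow along which \<mu> could be
  transported, and of several integral curves through a point of the support some may leave it. So
  one can only hope for some curve through each point that stays inside. Where \<open>X\<close> is
  nearly constant and nonzero, a nonzero function with small compact support must decrease along
  \<open>X\<close> somewhere; hence the cutoff, whose decrease is harmless because \<mu> does not
  charge the complement of the support. On the rest, nonnegativity of \<mu> is what turns a
  vanishing integral into vanishing of the continuous integrand at points of the support. Continuity
  of \<open>X\<close> suffices because the paraboloid shrinks with \<open>h\<close>, so that
  \<open>X\<close> is nearly constant on it. The error \<epsilon> h per step is the right size:
  about 1/h steps fill a fixed time, and the accumulated error is of order \<epsilon>.\<close>

lemma Ck_on_cong: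
  assumes "open S" "\<And>x. x \<in> S \<Longrightarrow> f x = g x" "Ck_on k S f"
  shows "Ck_on k S g"
  using assms(2,3)
proof (induction k arbitrary: f g)
  case 0
  then show ?case using continuous_on_cong by fastforce
next
  case (Suc k)
  have d: "(g has_derivative frechet_derivative f (at x)) (at x)" if "x \<in> S" for x
  proof -
    have "(f has_derivative frechet_derivative f (at x)) (at x)"
      using Suc.prems(2) that frechet_derivative_works by auto
    then show ?thesis
      using has_derivative_transform_within_open[OF _ \<open>open S\<close> that] Suc.prems(1) by blast
  qed
  then have "frechet_derivative g (at x) = frechet_derivative f (at x)" if "x \<in> S" for x
    using frechet_derivative_at that by metis
  then have "Ck_on k S (\<lambda>x. frechet_derivative g (at x) v)" for v
    using Suc.IH[of "\<lambda>x. frechet_derivative f (at x) v"] Suc.prems(2) by simp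
  then show ?case using d by (auto simp: differentiable_def)
qed

text \<open>\<open>Ck_on\<close> refers to \<open>frechet_derivative\<close>, a choice term. This
  rule replaces it by a derivative that is known explicitly, which is how the inductions below
  proceed.\<close>

lemma Ck_on_SucI:
  assumes "open S" "\<And>x. x \<in> S \<Longrightarrow> (f has_derivative f' x) (at x)"
    "\<And>v. Ck_on k S (\<lambda>x. f' x v)"
  shows "Ck_on (Suc k) S f"
proof -
  have "frechet_derivative f (at x) = f' x" if "x \<in> S" for x
    using frechet_derivative_at assms(2) that by metis
  then have "Ck_on k S (\<lambda>x. frechet_derivative f (at x) v)" for v
    using Ck_on_cong[OF assms(1) _ assms(3)[of v], of "\<lambda>x. frechet_derivative f (at x) v"] by simp
  then show ?thesis using assms(2) by (auto simp: differentiable_def)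
qed

lemma Ck_on_Suc_has_derivative:
  "Ck_on (Suc k) S f \<Longrightarrow> x \<in> S \<Longrightarrow> (f has_derivative frechet_derivative f (at x)) (at x)"
  using frechet_derivative_works by auto

lemma Ck_on_continuous_on: "Ck_on k S f \<Longrightarrow> continuous_on S f"
  by (cases k) (auto intro!: continuous_at_imp_continuous_on differentiable_imp_continuous_within)

lemma Ck_on_Suc_imp: "Ck_on (Suc k) S f \<Longrightarrow> Ck_on k S f"
proof (induction k arbitrary: f)
  case 0
  then show ?case using Ck_on_continuous_on[of "Suc 0"] by simp
next
  case (Suc k)
  then show ?case by auto
qed

lemma Ck_on_const: "open S \<Longrightarrow> Ck_on k S (\<lambda>x. c)"
proof (induction k arbitrary: c)
  case (Suc k)
  show ?case by (rule Ck_on_SucI[where f' = "\<lambda>_ _. 0"]) (use Suc in auto)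
qed simp

lemma Ck_on_linear:
  assumes "open S" "bounded_linear f" shows "Ck_on k S f"
proof (cases k)
  case 0
  then show ?thesis using assms linear_continuous_on by auto
next
  case (Suc k')
  show ?thesis unfolding Suc
    by (rule Ck_on_SucI[where f' = "\<lambda>_. f"])
      (use assms Ck_on_const bounded_linear_imp_has_derivative in auto)
qed

lemma Ck_on_linear_compose:
  assumes "open S" "bounded_linear l" "Ck_on k S f"
  shows "Ck_on k S (\<lambda>x. l (f x))"
  using assms(3)
proof (induction k arbitrary: f)
  case 0
  then show ?case using assms(2) bounded_linear.continuous_on by auto
next
  case (Suc k)
  show ?case
  proof (rule Ck_on_SucI[OF assms(1)])
    show "((\<lambda>x. l (f x)) has_derivative (\<lambda>v. l (frechet_derivative f (at x) v))) (at x)" if "x \<in> S" for x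
      using bounded_linear.has_derivative[OF assms(2)] Ck_on_Suc_has_derivative[OF Suc.prems that] by blast
  qed (use Suc in auto)
qed

lemma Ck_on_add:
  assumes "open S" "Ck_on k S f" "Ck_on k S g"
  shows "Ck_on k S (\<lambda>x. f x + g x)"
  using assms(2,3)
proof (induction k arbitrary: f g)
  case 0
  then show ?case using continuous_on_add by auto
next
  case (Suc k)
  show ?case
    by (rule Ck_on_SucI[OF assms(1) has_derivative_add[OF
      Ck_on_Suc_has_derivative[OF Suc.prems(1)] Ck_on_Suc_has_derivative[OF Suc.prems(2)]]])
      (use Suc in auto)
qed

lemma Ck_on_sum:
  assumes "open S" "finite I" "\<And>i. i \<in> I \<Longrightarrow> Ck_on k S (f i)"
  shows "Ck_on k S (\<lambda>x. \<Sum>i\<in>I. f i x)"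
  using assms(2,3) by (induction rule: finite_induct) (auto simp: assms(1) Ck_on_const intro!: Ck_on_add)

text \<open>One Leibniz rule for products, scalings and inner products. In each summand of the
  derivative one factor stays undifferentiated; \<open>Ck_on_Suc_imp\<close> lowers its order so
  that the induction hypothesis applies.\<close>

lemma Ck_on_bilinear:
  assumes "open S" "bounded_bilinear p" "Ck_on k S f" "Ck_on k S g"
  shows "Ck_on k S (\<lambda>x. p (f x) (g x))"
  using assms(3,4)
proof (induction k arbitrary: f g)
  case 0
  then show ?case using assms(2) bounded_bilinear.continuous_on by auto
next
  case (Suc k)
  show ?case
  proof (rule Ck_on_SucI[OF assms(1) bounded_bilinear.FDERIV[OF assms(2)
      Ck_on_Suc_has_derivative[OF Suc.prems(1)] Ck_on_Suc_has_derivative[OF Suc.prems(2)]]])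
    show "Ck_on k S (\<lambda>x. p (f x) (frechet_derivative g (at x) v) + p (frechet_derivative f (at x) v) (g x))" for v
      using Suc.IH Ck_on_Suc_imp[OF Suc.prems(1)] Ck_on_Suc_imp[OF Suc.prems(2)] Suc.prems
      by (intro Ck_on_add assms(1)) auto
  qed auto
qed

lemma linear_basis_expansion:
  fixes l :: "'a::euclidean_space \<Rightarrow> 'b::real_normed_vector"
  assumes "bounded_linear l"
  shows "l v = (\<Sum>b\<in>Basis. (v \<bullet> b) *\<^sub>R l b)"
proof -
  have "l v = l (\<Sum>b\<in>Basis. (v \<bullet> b) *\<^sub>R b)" by (simp add: euclidean_representation)
  also have "\<dots> = (\<Sum>b\<in>Basis. (v \<bullet> b) *\<^sub>R l b)"
    using assms bounded_linear.linear linear_sum linear_cmul by (metis (mono_tags, lifting) sum.cong)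
  finally show ?thesis .
qed

lemma Ck_on_compose:
  fixes f :: "'a::euclidean_space \<Rightarrow> 'b::euclidean_space" and g :: "'b \<Rightarrow> 'c::real_normed_vector"
  assumes "open S" "f ` S \<subseteq> T" "Ck_on k S f" "Ck_on k T g"
  shows "Ck_on k S (\<lambda>x. g (f x))"
  using assms(3,4)
proof (induction k arbitrary: g)
  case 0
  then show ?case using continuous_on_compose2[OF _ _ assms(2)] by auto
next
  case (Suc k)
  \<comment> \<open>In the chain rule the direction in which \<open>g\<close> is differentiated
    depends on \<open>x\<close>, whereas the induction hypothesis speaks of fixed directions.
    Expansion in the basis separates the two.\<close>
  let ?D = "\<lambda>x v. \<Sum>b\<in>Basis. (frechet_derivative f (at x) v \<bullet> b) *\<^sub>R frechet_derivative g (at (f x)) b"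
  have "((\<lambda>x. g (f x)) has_derivative ?D x) (at x)" if "x \<in> S" for x
  proof -
    have *: "(f has_derivative frechet_derivative f (at x)) (at x)"
      "(g has_derivative frechet_derivative g (at (f x))) (at (f x))"
      using Ck_on_Suc_has_derivative[OF Suc.prems(1)] Ck_on_Suc_has_derivative[OF Suc.prems(2)]
        that assms(2) by auto
    have "((\<lambda>x. g (f x)) has_derivative (\<lambda>v. frechet_derivative g (at (f x)) (frechet_derivative f (at x) v))) (at x)"
      using diff_chain_at[OF *] by (simp add: o_def)
    moreover have "frechet_derivative g (at (f x)) (frechet_derivative f (at x) v) = ?D x v" for v
      using linear_basis_expansion *(2) has_derivative_bounded_linear by blast
    ultimately show ?thesis by simp
  qed
  moreover have "Ck_on k S (\<lambda>x. ?D x v)" for v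
  proof (intro Ck_on_sum assms(1) Ck_on_bilinear[OF _ bounded_bilinear_scaleR])
    fix b :: 'b
    have "Ck_on k S (\<lambda>x. frechet_derivative f (at x) v)" using Suc.prems by auto
    then show "Ck_on k S (\<lambda>x. frechet_derivative f (at x) v \<bullet> b)"
      using Ck_on_linear_compose[OF assms(1) bounded_linear_inner_left] by blast
    show "Ck_on k S (\<lambda>x. frechet_derivative g (at (f x)) b)"
      using Suc.IH[of "\<lambda>y. frechet_derivative g (at y) b"] Suc.prems Ck_on_Suc_imp by auto
  qed auto
  ultimately show ?case by (intro Ck_on_SucI[OF assms(1)])
qed

lemma Ck_on_subset: "Ck_on k S f \<Longrightarrow> T \<subseteq> S \<Longrightarrow> Ck_on k T f"
  by (induction k arbitrary: f) (auto intro: continuous_on_subset)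

lemma Ck_on_open_Un:
  "open S \<Longrightarrow> open T \<Longrightarrow> Ck_on k S f \<Longrightarrow> Ck_on k T f \<Longrightarrow> Ck_on k (S \<union> T) f"
  by (induction k arbitrary: f) (auto intro: continuous_on_open_Un)

text \<open>The index makes the family closed under differentiation, up to linear combinations.\<close>

definition flat :: "nat \<Rightarrow> real \<Rightarrow> real" where
  "flat n x = (if x > 0 then inverse x ^ n * exp (- inverse x) else 0)"

text \<open>With y = 1/x, a single term of the exponential series gives y^(n+1) / (n+1)! \<le> exp
  y. The resulting linear bound is enough for the limit at 0.\<close>

lemma flat_bound: "\<bar>flat n x\<bar> \<le> fact (Suc n) * \<bar>x\<bar>"
proof (cases "x > 0")
  case True
  define y where "y = inverse x"
  have y: "y > 0" using True y_def by simp
  have "y ^ Suc n /\<^sub>R fact (Suc n) \<le> exp y"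
  proof -
    have "(\<Sum>k\<in>{Suc n}. y ^ k /\<^sub>R fact k) \<le> exp y" unfolding exp_def
      by (rule sum_le_suminf[OF summable_exp_generic]) (use y in auto)
    then show ?thesis by simp
  qed
  then have "y ^ n * y \<le> fact (Suc n) * exp y"
    by (simp add: field_simps del: fact_Suc)
  then have "y ^ n * exp (- y) \<le> fact (Suc n) / y"
    using y by (simp add: exp_minus field_simps del: fact_Suc)
  then show ?thesis using True y by (simp add: flat_def y_def divide_inverse)
next
  case False
  then have "\<bar>flat n x\<bar> = 0" by (simp add: flat_def)
  then show ?thesis by (metis abs_ge_zero fact_ge_zero mult_nonneg_nonneg)
qed

lemma flat_tendsto_0: "(flat n \<longlongrightarrow> 0) (at 0)"
proof -
  have "((\<lambda>x. fact (Suc n) * \<bar>x\<bar>) \<longlongrightarrow> fact (Suc n) * \<bar>0::real\<bar>) (at 0)"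
    by (intro tendsto_intros)
  then have *: "((\<lambda>x::real. fact (Suc n) * \<bar>x\<bar>) \<longlongrightarrow> 0) (at 0)" by (simp del: fact_Suc)
  show ?thesis
    by (rule Lim_null_comparison[OF _ *]) (use flat_bound in auto)
qed

lemma flat_has_derivative:
  "(flat n has_real_derivative (flat (n + 2) x - real n * flat (n + 1) x)) (at x)"
proof -
  consider "x > 0" | "x = 0" | "x < 0" by linarith
  then show ?thesis
  proof cases
    case 1
    have "((\<lambda>x. inverse x ^ n * exp (- inverse x)) has_real_derivative
       (real n * inverse x ^ (n - 1) * (- (inverse x)\<^sup>2) * exp (- inverse x)
        + exp (- inverse x) * (inverse x)\<^sup>2 * inverse x ^ n)) (at x)"
      by (use 1 in \<open>auto intro!: derivative_eq_intros simp: power2_eq_square\<close>)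
    also have "real n * inverse x ^ (n - 1) * (- (inverse x)\<^sup>2) * exp (- inverse x)
        + exp (- inverse x) * (inverse x)\<^sup>2 * inverse x ^ n = flat (n + 2) x - real n * flat (n + 1) x"
      using 1 by (cases n) (simp_all add: flat_def power2_eq_square algebra_simps)
    finally have "((\<lambda>x. inverse x ^ n * exp (- inverse x)) has_real_derivative
       (flat (n + 2) x - real n * flat (n + 1) x)) (at x)" .
    then show ?thesis
      by (rule has_field_derivative_transform_within_open[of _ _ _ "{0<..}"])
        (use 1 in \<open>auto simp: flat_def\<close>)
  next
    case 2
    \<comment> \<open>Dividing by the increment only raises the index: the difference quotient at 0
      is \<open>flat (Suc n)\<close>.\<close>
    have "((\<lambda>y. (flat n y - flat n 0) / (y - 0)) \<longlongrightarrow> 0) (at 0)"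
    proof (rule Lim_transform_eventually[OF flat_tendsto_0[of "Suc n"]])
      show "\<forall>\<^sub>F y in at 0. flat (Suc n) y = (flat n y - flat n 0) / (y - 0)"
        by (auto simp: eventually_at_filter flat_def field_simps)
    qed
    then show ?thesis using 2 by (simp add: has_field_derivative_iff flat_def)
  next
    case 3
    have "((\<lambda>x. 0) has_real_derivative (flat (n + 2) x - real n * flat (n + 1) x)) (at x)"
      using 3 by (simp add: flat_def)
    then show ?thesis
      by (rule has_field_derivative_transform_within_open[of _ _ _ "{..<0}"])
        (use 3 in \<open>auto simp: flat_def\<close>)
  qed
qed

lemma Ck_on_flat: "Ck_on k UNIV (flat n)"
proof (induction k arbitrary: n)
  case 0
  show ?case using flat_has_derivative DERIV_isCont continuous_at_imp_continuous_on by (metis Ck_on.simps(1))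
next
  case (Suc k)
  show ?case
  proof (rule Ck_on_SucI)
    show "(flat n has_derivative (\<lambda>v. (flat (n + 2) x + (- real n) * flat (n + 1) x) * v)) (at x)" for x
      using flat_has_derivative[of n x] by (simp add: has_field_derivative_def)
    show "Ck_on k UNIV (\<lambda>x. (flat (n + 2) x + (- real n) * flat (n + 1) x) * v)" for v
      by (intro Ck_on_bilinear[OF _ bounded_bilinear_mult] Ck_on_add Ck_on_const Suc) auto
  qed auto
qed

section \<open>Functions and vector fields in charts\<close>

lemma chart_inverse:
  assumes "is_chart c"
  shows "m \<in> chart_dom c \<Longrightarrow> param c (coords c m) = m"
    "z \<in> coords c ` chart_dom c \<Longrightarrow> coords c (param c z) = z"
    "z \<in> coords c ` chart_dom c \<Longrightarrow> param c z \<in> chart_dom c"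
  using assms by (auto simp: is_chart_def homeomorphism_def)

lemma chart_open_image:
  assumes "is_chart c" "open W" "W \<subseteq> chart_dom c"
  shows "open (coords c ` W)"
proof -
  have "openin (top_of_set (coords c ` chart_dom c)) (coords c ` W)"
    using assms homeomorphism_imp_open_map openin_open_eq unfolding is_chart_def by metis
  then show ?thesis using assms(1) openin_open_eq unfolding is_chart_def by blast
qed

lemma chart_continuous:
  assumes "is_chart c"
  shows "continuous_on (chart_dom c) (coords c)"
    "continuous_on (coords c ` chart_dom c) (param c)"
  using assms by (auto simp: is_chart_def homeomorphism_def)

locale continuous_vf =
  fixes A :: "('a::{t2_space,second_countable_topology}, 'e::euclidean_space) chart set"
    and U :: "'a set"
    and X :: "'a \<Rightarrow> ('a, 'e) chart \<Rightarrow> 'e"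
  assumes atlas: "smooth_atlas A" and open_U: "open U" and vf: "continuous_vector_field A U X"
begin

lemma chart: "c \<in> A \<Longrightarrow> is_chart c"
  using atlas by (simp add: smooth_atlas_def)

lemma open_chart_dom: "c \<in> A \<Longrightarrow> open (chart_dom c)"
  using chart by (simp add: is_chart_def)

lemma obtain_chart: obtains c where "c \<in> A" "m \<in> chart_dom c"
proof -
  have "m \<in> (\<Union>c\<in>A. chart_dom c)" using atlas unfolding smooth_atlas_def by blast
  then show thesis using that by blast
qed

lemma continuous_X: "c \<in> A \<Longrightarrow> continuous_on (U \<inter> chart_dom c) (\<lambda>m. X m c)"
  using vf by (simp add: continuous_vector_field_def)

lemma transition_has_derivative:
  assumes "c \<in> A" "d \<in> A" "m \<in> chart_dom c" "m \<in> chart_dom d"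
  shows "((coords d \<circ> param c) has_derivative frechet_derivative (coords d \<circ> param c) (at (coords c m)))
    (at (coords c m))"
proof -
  have "Ck_on (Suc 0) (coords c ` (chart_dom c \<inter> chart_dom d)) (coords d \<circ> param c)"
    using atlas assms by (auto simp: smooth_atlas_def smooth_on_def simp del: Ck_on.simps)
  then show ?thesis using assms Ck_on_Suc_has_derivative by blast
qed

lemma X_transition:
  assumes "c \<in> A" "d \<in> A" "m \<in> U" "m \<in> chart_dom c" "m \<in> chart_dom d"
  shows "X m d = frechet_derivative (coords d \<circ> param c) (at (coords c m)) (X m c)"
  using vf assms unfolding continuous_vector_field_def tangent_vector_def by blast

text \<open>Transports a test function from coordinates to the manifold. Smoothness has to be
  checked in every chart, and \<open>derivative_along\<close> computes in a chart picked by
  \<open>SOME\<close>, hence the transition maps in the proof.\<close>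

lemma chart_test_function:
  fixes F :: "'e \<Rightarrow> real"
  assumes c: "c \<in> A" and F: "smooth_on UNIV F" and K: "compact K" "K \<subseteq> coords c ` (U \<inter> chart_dom c)"
    and supp: "\<And>z. F z \<noteq> 0 \<Longrightarrow> z \<in> K"
  defines "f \<equiv> \<lambda>m. if m \<in> U \<inter> chart_dom c then F (coords c m) else 0"
  shows "test_function A U f"
    and "m \<in> U \<Longrightarrow> derivative_along A X f m =
      (if m \<in> U \<inter> chart_dom c then frechet_derivative F (at (coords c m)) (X m c) else 0)"
    and "compact (param c ` K)" "param c ` K \<subseteq> U \<inter> chart_dom c"
proof -
  define P where "P = param c ` K"
  note cc = chart[OF c]
  have P: "P \<subseteq> U \<inter> chart_dom c"
  proof
    fix m assume "m \<in> P"
    then obtain z where "z \<in> K" "m = param c z" by (auto simp: P_def)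
    moreover from this K(2) obtain m' where "m' \<in> U \<inter> chart_dom c" "z = coords c m'" by blast
    ultimately show "m \<in> U \<inter> chart_dom c" using chart_inverse(1)[OF cc, of m'] by simp
  qed
  have "compact P" unfolding P_def
    using K continuous_on_subset[OF chart_continuous(2)[OF cc], of K] by (intro compact_continuous_image) auto
  \<comment> \<open>The Hausdorff property enters here: the extension by zero is smooth because the
    complement of \<open>P\<close> is open.\<close>
  then have "closed P" by (rule compact_imp_closed)
  have fP: "f m \<noteq> 0 \<Longrightarrow> m \<in> P" for m
  proof -
    assume "f m \<noteq> 0"
    then have "m \<in> chart_dom c" "coords c m \<in> K" using supp by (auto simp: f_def split: if_splits)
    then show "m \<in> P" using chart_inverse(1)[OF cc, of m] unfolding P_def by (metis imageI)
  qed
  \<comment> \<open>In each chart \<open>d\<close> two open sets cover the image of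
    \<open>U\<close>: on \<open>S1 d\<close> the function is \<open>F\<close> after a transition
    map, on \<open>S2 d\<close> it is zero.\<close>
  define S1 where "S1 d = coords d ` (U \<inter> chart_dom d \<inter> chart_dom c)" for d :: "('a, 'e) chart"
  define S2 where "S2 d = coords d ` (U \<inter> chart_dom d - P)" for d :: "('a, 'e) chart"
  have S12: "coords d ` (U \<inter> chart_dom d) = S1 d \<union> S2 d" for d
    using P by (auto simp: S1_def S2_def)
  have open_S: "open (S1 d)" "open (S2 d)" if "d \<in> A" for d
    unfolding S1_def S2_def using chart[OF that] open_U open_chart_dom that c \<open>closed P\<close>
    by (auto intro!: chart_open_image)
  have f1: "F ((coords c \<circ> param d) z) = (f \<circ> param d) z" if d: "d \<in> A" and z: "z \<in> S1 d" for d z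
  proof -
    obtain m where "m \<in> U" "m \<in> chart_dom d" "m \<in> chart_dom c" "z = coords d m"
      using z by (auto simp: S1_def)
    then show ?thesis using chart_inverse(1)[OF chart[OF d], of m] by (simp add: f_def)
  qed
  have f2: "0 = (f \<circ> param d) z" if d: "d \<in> A" and z: "z \<in> S2 d" for d z
  proof -
    obtain m where "m \<in> chart_dom d" "m \<notin> P" "z = coords d m" using z by (auto simp: S2_def)
    then show ?thesis using chart_inverse(1)[OF chart[OF d], of m] fP[of m] by auto
  qed
  show "test_function A U f" unfolding test_function_def
  proof (intro conjI ballI)
    fix d assume d: "d \<in> A"
    show "smooth_on (coords d ` (U \<inter> chart_dom d)) (f \<circ> param d)" unfolding smooth_on_def S12
    proof (intro allI Ck_on_open_Un open_S d)
      fix k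
      have "Ck_on k (coords d ` (chart_dom d \<inter> chart_dom c)) (coords c \<circ> param d)"
        using atlas c d by (simp add: smooth_atlas_def smooth_on_def)
      then have "Ck_on k (S1 d) (coords c \<circ> param d)"
        by (rule Ck_on_subset) (auto simp: S1_def)
      then have "Ck_on k (S1 d) (\<lambda>z. F ((coords c \<circ> param d) z))"
        using Ck_on_compose[OF open_S(1)[OF d], of "coords c \<circ> param d" UNIV k F] F
        by (simp add: smooth_on_def)
      then show "Ck_on k (S1 d) (f \<circ> param d)"
        by (rule Ck_on_cong[OF open_S(1)[OF d] f1[OF d], rotated])
      show "Ck_on k (S2 d) (f \<circ> param d)"
        by (rule Ck_on_cong[OF open_S(2)[OF d] f2[OF d] Ck_on_const[OF open_S(2)[OF d]]])
    qed
  next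
    have "closure {m. f m \<noteq> 0} \<subseteq> P" using fP \<open>closed P\<close> by (intro closure_minimal) auto
    then show "compact (closure {m. f m \<noteq> 0})" "closure {m. f m \<noteq> 0} \<subseteq> U"
      using \<open>compact P\<close> P compact_Int_closed[of P "closure {m. f m \<noteq> 0}"] by (auto simp: inf.absorb2)
  qed
  show "derivative_along A X f m =
      (if m \<in> U \<inter> chart_dom c then frechet_derivative F (at (coords c m)) (X m c) else 0)" if m: "m \<in> U"
  proof -
    define d where "d = (SOME c. c \<in> A \<and> m \<in> chart_dom c)"
    have "\<exists>c. c \<in> A \<and> m \<in> chart_dom c" using obtain_chart by blast
    then have d: "d \<in> A" "m \<in> chart_dom d" unfolding d_def by (metis (mono_tags, lifting) someI_ex)+
    have *: "derivative_along A X f m = D (X m d)" if "((f \<circ> param d) has_derivative D) (at (coords d m))" for D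
      using frechet_derivative_at[OF that] by (simp add: derivative_along_def d_def Let_def)
    show ?thesis
    proof (cases "m \<in> chart_dom c")
      case True
      let ?T = "coords c \<circ> param d"
      have z: "coords d m \<in> S1 d" using True m d by (auto simp: S1_def)
      have Tz: "?T (coords d m) = coords c m" using chart_inverse(1)[OF chart] d by simp
      have 1: "(?T has_derivative frechet_derivative ?T (at (coords d m))) (at (coords d m))"
        using transition_has_derivative True d c by blast
      have "Ck_on (Suc 0) UNIV F" using F unfolding smooth_on_def by blast
      then have 2: "(F has_derivative frechet_derivative F (at (coords c m))) (at (coords c m))"
        using Ck_on_Suc_has_derivative by blast
      have "((\<lambda>z. F (?T z)) has_derivative
          (\<lambda>v. frechet_derivative F (at (coords c m)) (frechet_derivative ?T (at (coords d m)) v))) (at (coords d m))"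
        using diff_chain_at[OF 1, unfolded Tz, OF 2] by (simp add: o_def)
      then have "((f \<circ> param d) has_derivative
          (\<lambda>v. frechet_derivative F (at (coords c m)) (frechet_derivative ?T (at (coords d m)) v))) (at (coords d m))"
        by (rule has_derivative_transform_within_open[OF _ open_S(1)[OF d(1)] z]) (use f1 d in auto)
      from *[OF this] show ?thesis using X_transition[OF d(1) c m d(2) True] m True by simp
    next
      case False
      then have z: "coords d m \<in> S2 d" using m d P by (auto simp: S2_def)
      have "((f \<circ> param d) has_derivative (\<lambda>v. 0)) (at (coords d m))"
        by (rule has_derivative_transform_within_open[OF has_derivative_const open_S(2)[OF d(1)] z])
          (use f2 d in auto)
      from *[OF this] show ?thesis using False by simp
    qed
  qed
  show "compact (param c ` K)" "param c ` K \<subseteq> U \<inter> chart_dom c"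
    using \<open>compact P\<close> P by (simp_all add: P_def)
qed

lemma continuous_derivative:
  fixes F :: "'e \<Rightarrow> real"
  assumes "c \<in> A" "smooth_on UNIV F"
  shows "continuous_on (U \<inter> chart_dom c) (\<lambda>m. frechet_derivative F (at (coords c m)) (X m c))"
proof -
  have F: "Ck_on (Suc 0) UNIV F" using assms(2) unfolding smooth_on_def by blast
  \<comment> \<open>Base point and direction vary together; the expansion reduces the claim to
    derivatives in fixed directions.\<close>
  have eq: "frechet_derivative F (at z) v = (\<Sum>b\<in>Basis. (v \<bullet> b) *\<^sub>R frechet_derivative F (at z) b)" for z v
    using linear_basis_expansion[OF has_derivative_bounded_linear] Ck_on_Suc_has_derivative[OF F] by blast
  have "continuous_on (U \<inter> chart_dom c)
      (\<lambda>m. \<Sum>b\<in>Basis. (X m c \<bullet> b) *\<^sub>R frechet_derivative F (at (coords c m)) b)"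
  proof (intro continuous_intros continuous_X assms(1))
    fix b
    have "continuous_on UNIV (\<lambda>z. frechet_derivative F (at z) b)" using F by simp
    then show "continuous_on (U \<inter> chart_dom c) (\<lambda>m. frechet_derivative F (at (coords c m)) b)"
      by (rule continuous_on_compose2)
        (use continuous_on_subset[OF chart_continuous(1)[OF chart[OF assms(1)]], of "U \<inter> chart_dom c"] in auto)
  qed
  then show ?thesis by (rule continuous_on_eq) (rule eq[symmetric])
qed

lemma continuous_vf_uminus: "continuous_vf A U (\<lambda>m c. - X m c)"
proof
  show "continuous_vector_field A U (\<lambda>m c. - X m c)"
    unfolding continuous_vector_field_def tangent_vector_def
  proof (intro conjI ballI impI)
    fix m c d assume *: "m \<in> U" "c \<in> A" "d \<in> A" "m \<in> chart_dom c" "m \<in> chart_dom d"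
    show "- X m d = frechet_derivative (coords d \<circ> param c) (at (coords c m)) (- X m c)"
      using X_transition[OF *(2,3,1,4,5)] linear_neg[OF has_derivative_linear[OF transition_has_derivative[OF *(2-)]]]
      by simp
  next
    show "continuous_on (U \<inter> chart_dom c) (\<lambda>m. - X m c)" if "c \<in> A" for c
      by (rule continuous_on_minus[OF continuous_X[OF that]])
  qed
qed (use atlas open_U in auto)

lemma derivative_along_uminus:
  assumes "test_function A U f" "m \<in> U"
  shows "derivative_along A (\<lambda>m c. - X m c) f m = - derivative_along A X f m"
proof -
  define d where "d = (SOME c. c \<in> A \<and> m \<in> chart_dom c)"
  have "\<exists>c. c \<in> A \<and> m \<in> chart_dom c" using obtain_chart by blast
  then have d: "d \<in> A" "m \<in> chart_dom d" unfolding d_def by (metis (mono_tags, lifting) someI_ex)+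
  have "Ck_on (Suc 0) (coords d ` (U \<inter> chart_dom d)) (f \<circ> param d)"
    using assms d unfolding test_function_def smooth_on_def by blast
  then have "linear (frechet_derivative (f \<circ> param d) (at (coords d m)))"
    using Ck_on_Suc_has_derivative d assms has_derivative_linear by blast
  from linear_neg[OF this] show ?thesis by (simp add: derivative_along_def d_def Let_def)
qed

end

section \<open>Euler steps inside the support\<close>

lemma flat_nonneg: "0 \<le> flat n x" and flat_pos: "x > 0 \<Longrightarrow> 0 < flat n x"
  and flat_zero: "x \<le> 0 \<Longrightarrow> flat n x = 0"
  by (auto simp: flat_def)

lemma flat_0_mono: "x \<le> y \<Longrightarrow> flat 0 x \<le> flat 0 y"
  by (auto simp: flat_def le_imp_inverse_le)

lemma flat_0_has_derivative: "(flat 0 has_real_derivative flat 2 x) (at x)"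
  using flat_has_derivative[of 0 x] by (simp add: numeral_2_eq_2)

text \<open>The region where the function is positive is a paraboloid around the axis \<open>v\<close>, with
  \<open>x0\<close> inside, cut off near \<open>x0 + h *\<^sub>R v\<close>. The function increases along every vector close to
  \<open>v\<close> because the paraboloid widens and its axis is almost parallel to that vector; only the cutoff,
  which lies in the ball around \<open>x0 + h *\<^sub>R v\<close>, makes it decrease.\<close>

lemma paraboloid_function:
  fixes x0 v :: "'e::euclidean_space"
  assumes \<epsilon>: "0 < \<epsilon>" "\<epsilon> < norm v" and h: "0 < h"
  obtains F :: "'e \<Rightarrow> real" where "smooth_on UNIV F"
    "\<And>z. F z \<noteq> 0 \<Longrightarrow> dist x0 z \<le> 2 * h * norm v"
    "\<And>z Y. norm (Y - v) \<le> \<epsilon> / 32 \<Longrightarrow> \<epsilon> * h < dist z (x0 + h *\<^sub>R v) \<Longrightarrow> 0 \<le> frechet_derivative F (at z) Y"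
    "\<And>z Y. dist x0 z > 2 * h * norm v \<Longrightarrow> frechet_derivative F (at z) Y = 0"
    "\<And>Y. norm (Y - v) \<le> \<epsilon> / 32 \<Longrightarrow> 0 < frechet_derivative F (at x0) Y"
proof -
  define l where "l = h * norm v"
  define e where "e = v /\<^sub>R norm v"
  \<comment> \<open>\<open>q\<close> is the length of the cutoff. By the choice of
    \<open>\<kappa>\<close> the squared radius stays below (\<epsilon> h)^2 / 2, so a point of the
    cut-off end has squared distance at most (\<epsilon> h)^2 / 4 + (\<epsilon> h)^2 / 2 from
    \<open>x0 + h *\<^sub>R v\<close>, and the ball contains it.\<close>
  define q where "q = \<epsilon> * h / 2"
  define \<kappa> where "\<kappa> = (\<epsilon> * h)\<^sup>2 / (4 * l)"
  have v: "norm v > 0" using \<epsilon> by linarith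
  have l: "l > 0" using v h by (simp add: l_def)
  have e: "e \<bullet> e = 1" "v = norm v *\<^sub>R e" "norm e = 1"
    using v by (auto simp: e_def power2_norm_eq_inner[symmetric] power2_eq_square)
  have q: "q > 0" "q < l"
  proof -
    show "q > 0" using \<epsilon> h by (simp add: q_def)
    have "\<epsilon> * h < norm v * h" using \<epsilon> h by simp
    moreover have "q < \<epsilon> * h" using \<epsilon> h by (simp add: q_def)
    ultimately show "q < l" by (simp add: l_def mult.commute)
  qed
  have \<kappa>: "\<kappa> > 0" using \<epsilon> h l by (simp add: \<kappa>_def)
  have \<kappa>l: "\<kappa> * (2 * l) = (\<epsilon> * h)\<^sup>2 / 2" using l by (simp add: \<kappa>_def)
  have \<kappa>v: "\<kappa> * norm v = \<epsilon>\<^sup>2 * h / 4"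
    using v h by (simp add: \<kappa>_def l_def power2_eq_square)
  define t where "t z = (z - x0) \<bullet> e" for z
  \<comment> \<open>\<open>p s\<close> is the squared radius at position \<open>s\<close> on the
    axis. The vertex is at \<open>- l\<close>, behind \<open>x0\<close>. The last factor is 1 up to
    \<open>l - q\<close>, vanishes at \<open>l\<close> and is nonpositive beyond, which closes the
    region.\<close>
  define p where "p s = \<kappa> * (s + l) * (1 - flat 0 (s - (l - q)) / flat 0 q)" for s
  define p' where "p' s = \<kappa> * (1 - flat 0 (s - (l - q)) / flat 0 q)
      - \<kappa> * (s + l) * flat 2 (s - (l - q)) / flat 0 q" for s
  \<comment> \<open>This is \<open>p (t z)\<close> minus the squared distance from the axis,
    expanded by Pythagoras. The region is where \<open>w\<close> is positive.\<close>
  define w where "w z = p (t z) + (t z)\<^sup>2 - (z - x0) \<bullet> (z - x0)" for z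
  define w' where "w' z Y = (p' (t z) + 2 * t z) * (Y \<bullet> e) - 2 * ((z - x0) \<bullet> Y)" for z Y
  define F where "F z = flat 0 (w z)" for z
  have \<theta>: "flat 0 q > 0" using flat_pos q by blast

  have p_der: "(p has_real_derivative p' s) (at s)" for s
  proof -
    have "((\<lambda>s. flat 0 (s - (l - q))) has_real_derivative flat 2 (s - (l - q))) (at s)"
    proof -
      have "((\<lambda>s. s - (l - q)) has_real_derivative 1) (at s)"
        by (auto intro!: derivative_eq_intros)
      from DERIV_chain'[OF this flat_0_has_derivative] show ?thesis by simp
    qed
    then show ?thesis unfolding p_def[abs_def] p'_def using \<theta>
      by (auto intro!: derivative_eq_intros simp: field_simps)
  qed
  have t_der: "(t has_derivative (\<lambda>Y. Y \<bullet> e)) (at z)" for z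
    unfolding t_def[abs_def] by (auto intro!: derivative_eq_intros)
  have w_der: "(w has_derivative w' z) (at z)" for z
  proof -
    have "((\<lambda>z. p (t z)) has_derivative (\<lambda>Y. p' (t z) * (Y \<bullet> e))) (at z)"
      using has_derivative_compose[OF t_der p_der[unfolded has_field_derivative_def]] by (simp add: mult.commute)
    then show ?thesis unfolding w_def[abs_def] w'_def[abs_def]
      by (auto intro!: derivative_eq_intros t_der simp: algebra_simps inner_commute)
  qed
  have F_der: "(F has_derivative (\<lambda>Y. flat 2 (w z) * w' z Y)) (at z)" for z
  proof -
    have "(flat 0 has_real_derivative flat 2 (w z)) (at (w z))"
      by (rule flat_0_has_derivative)
    from has_derivative_compose[OF w_der this[unfolded has_field_derivative_def]]
    show ?thesis unfolding F_def[abs_def] .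
  qed
  have F': "frechet_derivative F (at z) = (\<lambda>Y. flat 2 (w z) * w' z Y)" for z
    using frechet_derivative_at[OF F_der] by simp

  define y where "y z = z - x0 - t z *\<^sub>R e" for z
  have y: "y z \<bullet> e = 0" "y z \<bullet> y z = (z - x0) \<bullet> (z - x0) - (t z)\<^sup>2" for z
    using e(1) by (auto simp: y_def t_def power2_eq_square inner_commute algebra_simps)
  have w_y: "w z = p (t z) - (norm (y z))\<^sup>2" for z
    by (simp add: w_def power2_norm_eq_inner y)
  have region: "- l < t z" "t z < l" "(norm (y z))\<^sup>2 < (\<epsilon> * h)\<^sup>2 / 2" if "w z > 0" for z
  proof -
    have p: "p (t z) > 0" "(norm (y z))\<^sup>2 < p (t z)"
      using that unfolding w_y by (smt (verit) zero_le_power2)+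
    show "- l < t z"
    proof (rule ccontr)
      assume *: "\<not> - l < t z"
      then have "flat 0 (t z - (l - q)) = 0" using q l by (intro flat_zero) simp
      then have "p (t z) = \<kappa> * (t z + l)" by (simp add: p_def)
      also have "\<dots> \<le> 0" using * \<kappa> by (simp add: mult_le_0_iff)
      finally show False using p by simp
    qed
    show "t z < l"
    proof (rule ccontr)
      assume *: "\<not> t z < l"
      then have "flat 0 q \<le> flat 0 (t z - (l - q))" by (intro flat_0_mono) simp
      then have "1 - flat 0 (t z - (l - q)) / flat 0 q \<le> 0" using \<theta> by simp
      moreover have "\<kappa> * (t z + l) \<ge> 0" using * \<kappa> l by simp
      ultimately have "p (t z) \<le> 0" unfolding p_def by (rule mult_nonneg_nonpos[rotated])
      then show False using p by simp
    qed
    have "p (t z) \<le> \<kappa> * (t z + l) * 1" unfolding p_def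
      using \<kappa> \<open>- l < t z\<close> flat_nonneg \<theta> by (intro mult_left_mono) auto
    also have "\<dots> \<le> \<kappa> * (2 * l)" using \<open>t z < l\<close> \<kappa> by simp
    finally show "(norm (y z))\<^sup>2 < (\<epsilon> * h)\<^sup>2 / 2" using p(2) unfolding \<kappa>l by simp
  qed
  have pythagoras: "(norm (a *\<^sub>R e + y z))\<^sup>2 = a\<^sup>2 + (norm (y z))\<^sup>2" for a z
    using y(1)[of z] e(1) unfolding power2_norm_eq_inner
    by (simp add: inner_add_left inner_add_right inner_commute power2_eq_square)
  have \<epsilon>hl: "\<epsilon> * h \<le> l" using \<epsilon> h by (simp add: l_def mult.commute)
  have bound: "dist x0 z \<le> 2 * l" if "w z > 0" for z
  proof (rule power2_le_imp_le)
    have "(t z)\<^sup>2 \<le> l\<^sup>2" using region(1,2)[OF that] l by (intro abs_le_square_iff[THEN iffD1]) simp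
    moreover have "(\<epsilon> * h)\<^sup>2 \<le> l\<^sup>2" using \<epsilon>hl \<epsilon> h by (intro power_mono) auto
    moreover have "z - x0 = t z *\<^sub>R e + y z" by (simp add: y_def)
    then have "(dist x0 z)\<^sup>2 = (t z)\<^sup>2 + (norm (y z))\<^sup>2" using pythagoras by (metis dist_commute dist_norm)
    ultimately have "(dist x0 z)\<^sup>2 \<le> l\<^sup>2 + l\<^sup>2 / 2" using region(3)[OF that] by linarith
    moreover have "(2 * l)\<^sup>2 = 4 * l\<^sup>2" by (simp add: power_mult_distrib)
    ultimately show "(dist x0 z)\<^sup>2 \<le> (2 * l)\<^sup>2" using zero_le_power2[of l] by linarith
  qed (use l in simp)
  have terminal: "dist z (x0 + h *\<^sub>R v) \<le> \<epsilon> * h" if "w z > 0" "l - q < t z" for z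
  proof (rule power2_le_imp_le)
    have "h *\<^sub>R v = l *\<^sub>R e" using e(2) by (metis l_def scaleR_scaleR)
    then have "z - (x0 + h *\<^sub>R v) = (t z - l) *\<^sub>R e + y z" by (simp add: y_def algebra_simps)
    then have "(dist z (x0 + h *\<^sub>R v))\<^sup>2 = (t z - l)\<^sup>2 + (norm (y z))\<^sup>2" using pythagoras by (metis dist_norm)
    moreover have "(t z - l)\<^sup>2 \<le> q\<^sup>2" using region(2)[OF that(1)] that(2) by (intro abs_le_square_iff[THEN iffD1]) simp
    moreover have "q\<^sup>2 = (\<epsilon> * h)\<^sup>2 / 4" by (simp add: q_def power_divide)
    ultimately show "(dist z (x0 + h *\<^sub>R v))\<^sup>2 \<le> (\<epsilon> * h)\<^sup>2"
      using region(3)[OF that(1)] zero_le_power2[of "\<epsilon> * h"] by linarith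
  qed (use \<epsilon> h in simp)
  \<comment> \<open>Before the cutoff the squared radius grows along \<open>Y\<close> at rate at
    least (31/32) \<epsilon>^2 h / 4, while the deviation of \<open>Y\<close> from the axis costs at
    most 2 (\<epsilon> h) (\<epsilon> / 32). The tolerance \<epsilon> / 32 is small enough for the
    gain to win.\<close>
  have incr: "w' z Y > 0" if z: "w z > 0" "t z \<le> l - q" and Y: "norm (Y - v) \<le> \<epsilon> / 32" for z Y
  proof -
    have "p' (t z) = \<kappa>" using z(2) by (simp add: p'_def flat_zero)
    then have "w' z Y = \<kappa> * (Y \<bullet> e) - 2 * (y z \<bullet> Y)"
      by (simp add: w'_def y_def algebra_simps inner_commute)
    also have "y z \<bullet> Y = y z \<bullet> (Y - v)"
      using y(1)[of z] e(2) by (metis diff_zero inner_diff_right inner_scaleR_right mult_zero_right)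
    finally have w'_eq: "w' z Y = \<kappa> * (Y \<bullet> e) - 2 * (y z \<bullet> (Y - v))" .
    have "\<bar>(Y - v) \<bullet> e\<bar> \<le> \<epsilon> / 32"
      using Cauchy_Schwarz_ineq2[of "Y - v" e] Y e(3) by simp
    moreover have "v \<bullet> e = norm v" using e(1,2) by (metis inner_scaleR_left mult.right_neutral)
    ultimately have "Y \<bullet> e \<ge> norm v - \<epsilon> / 32" unfolding inner_diff_left by linarith
    then have "Y \<bullet> e \<ge> norm v * (31 / 32)" using \<epsilon> by simp
    then have "\<kappa> * (norm v * (31 / 32)) \<le> \<kappa> * (Y \<bullet> e)" using \<kappa> by (intro mult_left_mono) auto
    then have 1: "\<epsilon>\<^sup>2 * h / 4 * (31 / 32) \<le> \<kappa> * (Y \<bullet> e)" using \<kappa>v by (simp add: mult.assoc[symmetric])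
    have "(norm (y z))\<^sup>2 \<le> (\<epsilon> * h)\<^sup>2" using region(3)[OF z(1)] zero_le_power2[of "\<epsilon> * h"] by linarith
    then have "norm (y z) \<le> \<epsilon> * h" using \<epsilon> h by (intro power2_le_imp_le[of "norm (y z)"]) auto
    then have "norm (y z) * norm (Y - v) \<le> \<epsilon> * h * (\<epsilon> / 32)" using Y \<epsilon> h by (intro mult_mono) auto
    then have 2: "y z \<bullet> (Y - v) \<le> \<epsilon>\<^sup>2 * h / 32"
      using norm_cauchy_schwarz[of "y z" "Y - v"] by (simp add: power2_eq_square algebra_simps)
    have "\<epsilon>\<^sup>2 * h > 0" using \<epsilon> h by simp
    then show ?thesis using 1 2 unfolding w'_eq by linarith
  qed
  have w_x0: "w x0 > 0" "t x0 = 0"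
    using q l \<kappa> by (auto simp: w_def t_def p_def flat_zero)

  show thesis
  proof (rule that[of F])
    have t_smooth: "Ck_on k UNIV t" for k
    proof -
      have "Ck_on k UNIV (\<lambda>z. z \<bullet> e + - (x0 \<bullet> e))"
        by (intro Ck_on_add Ck_on_const Ck_on_linear bounded_linear_inner_left) auto
      then show ?thesis by (simp add: t_def[abs_def] inner_diff_left)
    qed
    have p_smooth: "Ck_on k UNIV p" for k
    proof -
      have shift: "Ck_on k UNIV (\<lambda>s::real. s + c)" for c
        by (intro Ck_on_add Ck_on_const Ck_on_linear bounded_linear_ident) auto
      have "Ck_on k UNIV (\<lambda>s. flat 0 (s + - (l - q)))"
        by (rule Ck_on_compose[OF open_UNIV subset_UNIV shift Ck_on_flat])
      note Ck_on_bilinear[OF open_UNIV bounded_bilinear_mult this Ck_on_const[OF open_UNIV, of k "- inverse (flat 0 q)"]]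
      note Ck_on_bilinear[OF open_UNIV bounded_bilinear_mult
          Ck_on_bilinear[OF open_UNIV bounded_bilinear_mult Ck_on_const[OF open_UNIV, of k \<kappa>] shift[of l]]
          Ck_on_add[OF open_UNIV Ck_on_const[OF open_UNIV, of k 1] this]]
      then show ?thesis by (simp add: p_def[abs_def] divide_inverse diff_diff_eq2 add_diff_eq)
    qed
    have "Ck_on k UNIV F" for k
    proof -
      have "Ck_on k UNIV (\<lambda>z. z + - x0)"
        by (intro Ck_on_add Ck_on_const Ck_on_linear bounded_linear_ident) auto
      then have "Ck_on k UNIV (\<lambda>z. (z + - x0) \<bullet> (z + - x0))"
        by (intro Ck_on_bilinear[OF open_UNIV bounded_bilinear_inner])
      moreover have "Ck_on k UNIV (\<lambda>z. p (t z))"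
        by (rule Ck_on_compose[OF open_UNIV subset_UNIV t_smooth p_smooth])
      moreover have "Ck_on k UNIV (\<lambda>z. t z * t z)"
        by (intro Ck_on_bilinear[OF open_UNIV bounded_bilinear_mult] t_smooth)
      ultimately have "Ck_on k UNIV (\<lambda>z. p (t z) + t z * t z + - ((z + - x0) \<bullet> (z + - x0)))"
        by (intro Ck_on_add[OF open_UNIV] Ck_on_linear_compose[OF open_UNIV bounded_linear_minus[OF bounded_linear_ident]])
      then have "Ck_on k UNIV w" by (simp add: w_def[abs_def] power2_eq_square)
      then show ?thesis unfolding F_def[abs_def]
        by (rule Ck_on_compose[OF open_UNIV subset_UNIV _ Ck_on_flat])
    qed
    then show "smooth_on UNIV F" by (simp add: smooth_on_def)
    show "dist x0 z \<le> 2 * h * norm v" if "F z \<noteq> 0" for z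
      using that bound[of z] flat_zero[of "w z" 0] unfolding F_def l_def by (cases "w z > 0") (auto simp: algebra_simps)
    show "frechet_derivative F (at z) Y = 0" if "dist x0 z > 2 * h * norm v" for z Y
      using that bound[of z] flat_zero[of "w z" 2] unfolding F' l_def by (cases "w z > 0") (auto simp: algebra_simps)
    show "0 \<le> frechet_derivative F (at z) Y"
      if "norm (Y - v) \<le> \<epsilon> / 32" "\<epsilon> * h < dist z (x0 + h *\<^sub>R v)" for z Y
    proof (cases "w z > 0")
      case True
      then have "t z \<le> l - q" using terminal[of z] that(2) by force
      then show ?thesis unfolding F' using incr[OF True _ that(1)] flat_nonneg[of 2 "w z"] by simp
    qed (simp add: F' flat_zero)
    show "0 < frechet_derivative F (at x0) Y" if "norm (Y - v) \<le> \<epsilon> / 32" for Y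
      unfolding F' using incr[OF w_x0(1) _ that] flat_pos[OF w_x0(1)] w_x0(2) q by simp
  qed
qed

section \<open>From the vanishing integral to points of the support\<close>

lemma AE_measure_supp:
  fixes \<mu> :: "'a::second_countable_topology measure"
  assumes "open U" "sets \<mu> = sets (restrict_space borel U)"
  shows "AE m in \<mu>. m \<in> measure_supp U \<mu>"
proof -
  define \<V> where "\<V> = {V. open V \<and> V \<subseteq> U \<and> emeasure \<mu> V = 0}"
  have null: "V \<in> null_sets \<mu>" if "V \<in> \<V>" for V
    using that assms by (auto simp: \<V>_def null_sets_def sets_restrict_space_iff)
  \<comment> \<open>An arbitrary union of null sets need not be null; second countability reduces it
    to a countable one.\<close>
  obtain \<V>' where \<V>': "\<V>' \<subseteq> \<V>" "countable \<V>'" "\<Union>\<V>' = \<Union>\<V>"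
    using Lindelof[of \<V>] by (auto simp: \<V>_def)
  have "(\<Union>V\<in>\<V>'. V) \<in> null_sets \<mu>"
    using \<V>' null by (intro null_sets_UN') auto
  then have "\<Union>\<V> \<in> null_sets \<mu>" using \<V>' by simp
  moreover have "space \<mu> = U"
    using sets_eq_imp_space_eq[OF assms(2)] by (simp add: space_restrict_space)
  ultimately show ?thesis
    by (intro AE_I'[of "\<Union>\<V>"]) (auto simp: measure_supp_def \<V>_def)
qed

locale invariant_measure = continuous_vf A U X
  for A :: "('a::{t2_space,second_countable_topology}, 'e::euclidean_space) chart set"
    and U :: "'a set"
    and X :: "'a \<Rightarrow> ('a, 'e) chart \<Rightarrow> 'e" +
  fixes \<mu> :: "'a measure"
  assumes density: "nonneg_density_measure U \<mu>" and invariant: "transpose_annihilates A U X \<mu>"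
begin

lemma sets_\<mu>: "sets \<mu> = sets (restrict_space borel U)"
  and finite_compact: "compact K \<Longrightarrow> K \<subseteq> U \<Longrightarrow> emeasure \<mu> K < \<infinity>"
  using density by (auto simp: nonneg_density_measure_def)

lemma space_\<mu>: "space \<mu> = U"
  using sets_eq_imp_space_eq[OF sets_\<mu>] by (simp add: space_restrict_space)

text \<open>A nonnegative integrand with integral zero vanishes almost everywhere. Being continuous,
  it is nonzero only on an open null set, and such a set misses the support. A sign condition on the
  support is enough, because \<mu> is concentrated there.\<close>

lemma derivative_eq_0_on_supp:
  fixes F :: "'e \<Rightarrow> real"
  assumes c: "c \<in> A" and F: "smooth_on UNIV F" and K: "compact K" "K \<subseteq> coords c ` (U \<inter> chart_dom c)"
    and F0: "\<And>z. F z \<noteq> 0 \<Longrightarrow> z \<in> K" and F'0: "\<And>z v. z \<notin> K \<Longrightarrow> frechet_derivative F (at z) v = 0"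
    and nonneg: "\<And>m. m \<in> measure_supp U \<mu> \<inter> chart_dom c \<Longrightarrow>
      0 \<le> frechet_derivative F (at (coords c m)) (X m c)"
    and m0: "m0 \<in> measure_supp U \<mu> \<inter> chart_dom c"
  shows "frechet_derivative F (at (coords c m0)) (X m0 c) = 0"
proof -
  define f where "f m = (if m \<in> U \<inter> chart_dom c then F (coords c m) else 0)" for m
  define g where "g m = (if m \<in> U \<inter> chart_dom c then frechet_derivative F (at (coords c m)) (X m c) else 0)" for m
  define P where "P = param c ` K"
  note test = chart_test_function[OF c F K F0, folded P_def]
  have f: "test_function A U f" and fg: "\<And>m. m \<in> U \<Longrightarrow> derivative_along A X f m = g m"
    using test(1,2) unfolding f_def[abs_def] g_def by auto
  have P: "compact P" "P \<subseteq> U \<inter> chart_dom c" using test(3,4) by auto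
  have gP: "m \<in> P" if "g m \<noteq> 0" for m
    using that F'0[of "coords c m"] chart_inverse(1)[OF chart[OF c], of m] unfolding g_def P_def
    by (metis IntD2 imageI)
  have cont: "continuous_on U g"
  proof -
    have "continuous_on (U \<inter> chart_dom c) g"
      by (rule continuous_on_eq[OF continuous_derivative[OF c F]]) (simp add: g_def)
    moreover have "continuous_on (U - P) g"
      by (rule continuous_on_eq[OF continuous_on_const[of _ 0]]) (use gP in auto)
    ultimately have "continuous_on ((U \<inter> chart_dom c) \<union> (U - P)) g"
      using P open_U open_chart_dom[OF c] by (intro continuous_on_open_Un open_Int open_Diff compact_imp_closed) auto
    moreover have "(U \<inter> chart_dom c) \<union> (U - P) = U" using P by auto
    ultimately show ?thesis by simp
  qed
  have meas: "g \<in> borel_measurable \<mu>"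
    using borel_measurable_continuous_on_restrict[OF cont] measurable_cong_sets[OF sets_\<mu> refl] by blast
  have "bounded (g ` P)"
    using P cont by (intro compact_imp_bounded compact_continuous_image) (auto intro: continuous_on_subset)
  then obtain B where B: "\<And>m. m \<in> P \<Longrightarrow> norm (g m) \<le> B" by (auto simp: bounded_iff)
  \<comment> \<open>Without integrability the integral would be 0 by convention and carry no
    information. \<open>g\<close> is bounded and vanishes outside the compact set \<open>P\<close>,
    which has finite measure.\<close>
  have "integrable \<mu> g"
  proof (rule integrableI_bounded_set)
    show "P \<in> sets \<mu>" using P open_U by (auto simp: sets_\<mu> sets_restrict_space_iff intro: borel_compact)
    show "emeasure \<mu> P < \<infinity>" using finite_compact P by blast
  qed (use meas B gP in auto)
  moreover have AE_supp: "AE m in \<mu>. m \<in> measure_supp U \<mu>"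
    by (rule AE_measure_supp[OF open_U sets_\<mu>])
  then have "AE m in \<mu>. 0 \<le> g m"
    by eventually_elim (use nonneg in \<open>auto simp: g_def\<close>)
  moreover have "integral\<^sup>L \<mu> g = 0"
  proof -
    have "integral\<^sup>L \<mu> g = (\<integral>m. derivative_along A X f m \<partial>\<mu>)"
      using fg by (intro Bochner_Integration.integral_cong refl) (simp add: space_\<mu>)
    then show ?thesis using invariant f by (simp add: transpose_annihilates_def)
  qed
  ultimately have "AE m in \<mu>. g m = 0" using integral_nonneg_eq_0_iff_AE by blast
  define V where "V = U \<inter> g -` (- {0})"
  have V: "open V" unfolding V_def using cont open_U by (intro continuous_open_preimage) auto
  then have V_sets: "V \<in> sets \<mu>" using open_U by (auto simp: V_def sets_\<mu> sets_restrict_space_iff)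
  from \<open>AE m in \<mu>. g m = 0\<close> have "AE m in \<mu>. m \<notin> V"
    by eventually_elim (simp add: V_def)
  then have "emeasure \<mu> V = 0"
    using V_sets AE_iff_measurable[OF V_sets, of "\<lambda>m. m \<notin> V"] by (auto simp: space_\<mu> V_def)
  then have "m0 \<notin> V" using m0 V unfolding measure_supp_def V_def by blast
  then show ?thesis using m0 by (auto simp: V_def g_def measure_supp_def)
qed

text \<open>The bound \<open>h0\<close> is the same for all base points, since an Euler scheme uses
  one step length throughout. The larger ball leaves room for paraboloids that reach beyond
  \<open>cball a r\<close>.\<close>

lemma supp_step:
  assumes c: "c \<in> A" and r: "r > 0" and a: "cball a (2 * r) \<subseteq> coords c ` (U \<inter> chart_dom c)" and \<epsilon>: "\<epsilon> > 0"
  defines "S \<equiv> coords c ` (measure_supp U \<mu> \<inter> chart_dom c)"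
  shows "\<exists>h0>0. \<forall>h x. 0 < h \<longrightarrow> h < h0 \<longrightarrow> x \<in> S \<inter> cball a r \<longrightarrow>
    (\<exists>y\<in>S. dist y (x + h *\<^sub>R X (param c x) c) \<le> \<epsilon> * h)"
proof -
  define Z where "Z x = X (param c x) c" for x
  note cc = chart[OF c]
  have Z: "continuous_on (cball a (2 * r)) Z"
  proof -
    have "continuous_on (cball a (2 * r)) (param c)"
      by (rule continuous_on_subset[OF chart_continuous(2)[OF cc]]) (use a in auto)
    moreover have "param c ` cball a (2 * r) \<subseteq> U \<inter> chart_dom c"
      using a chart_inverse(1)[OF cc] by (force simp: subset_iff image_iff)
    ultimately show ?thesis unfolding Z_def by (rule continuous_on_compose2[OF continuous_X[OF c]])
  qed
  have "bounded (Z ` cball a (2 * r))"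
    using Z by (intro compact_imp_bounded compact_continuous_image) auto
  then obtain B where B: "B > 0" "\<And>x. x \<in> cball a (2 * r) \<Longrightarrow> norm (Z x) \<le> B"
    unfolding bounded_pos by blast
  have "uniformly_continuous_on (cball a (2 * r)) Z"
    using Z by (intro compact_uniformly_continuous) auto
  then obtain \<rho> where \<rho>: "\<rho> > 0" "\<And>x y. x \<in> cball a (2 * r) \<Longrightarrow> y \<in> cball a (2 * r) \<Longrightarrow> dist y x < \<rho> \<Longrightarrow>
      dist (Z y) (Z x) < \<epsilon> / 32"
    unfolding uniformly_continuous_on_def using \<epsilon> by (metis divide_pos_pos zero_less_numeral)
  \<comment> \<open>The paraboloid lies within 2 h |Z x| of \<open>x\<close>. This choice keeps it
    in the larger ball and within the distance \<open>\<rho>\<close> on which \<open>Z\<close>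
    varies by less than \<epsilon> / 32, the tolerance of
    \<open>paraboloid_function\<close>.\<close>
  define h0 where "h0 = min r (\<rho> / 2) / (2 * B)"
  have "\<exists>y\<in>S. dist y (x + h *\<^sub>R Z x) \<le> \<epsilon> * h" if h: "0 < h" "h < h0" and x: "x \<in> S \<inter> cball a r" for h x
  proof (cases "norm (Z x) \<le> \<epsilon>")
    \<comment> \<open>Where the field is this small, staying at \<open>x\<close> is already an
      admissible step.\<close>
    case True
    then show ?thesis using x h by (intro bexI[of _ x]) (auto simp: dist_norm mult.commute)
  next
    case False
    then have v: "\<epsilon> < norm (Z x)" by simp
    show ?thesis
    proof (rule ccontr)
      assume far: "\<not> ?thesis"
      obtain F :: "'e \<Rightarrow> real" where F: "smooth_on UNIV F"
        "\<And>z. F z \<noteq> 0 \<Longrightarrow> dist x z \<le> 2 * h * norm (Z x)"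
        "\<And>z Y. norm (Y - Z x) \<le> \<epsilon> / 32 \<Longrightarrow> \<epsilon> * h < dist z (x + h *\<^sub>R Z x) \<Longrightarrow> 0 \<le> frechet_derivative F (at z) Y"
        "\<And>z Y. dist x z > 2 * h * norm (Z x) \<Longrightarrow> frechet_derivative F (at z) Y = 0"
        "\<And>Y. norm (Y - Z x) \<le> \<epsilon> / 32 \<Longrightarrow> 0 < frechet_derivative F (at x) Y"
        using paraboloid_function[OF \<epsilon> v h(1)] by blast
      define K where "K = cball x (2 * h * norm (Z x))"
      have xa: "x \<in> cball a (2 * r)" using x r by auto
      have "2 * h * norm (Z x) \<le> 2 * h * B" using h B(2)[OF xa] by simp
      also have "\<dots> < min r (\<rho> / 2)" using h B(1) by (simp add: h0_def field_simps)
      finally have small: "2 * h * norm (Z x) < r" "2 * h * norm (Z x) < \<rho>" using \<rho>(1) by auto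
      have Ka: "K \<subseteq> cball a (2 * r)"
      proof
        fix z assume "z \<in> K"
        then show "z \<in> cball a (2 * r)" using dist_triangle[of a z x] x small by (auto simp: K_def)
      qed
      obtain m0 where m0: "m0 \<in> measure_supp U \<mu> \<inter> chart_dom c" "x = coords c m0"
        using x by (auto simp: S_def)
      have Xm: "X m c = Z (coords c m)" if "m \<in> chart_dom c" for m
        using chart_inverse(1)[OF cc that] by (simp add: Z_def)
      have "frechet_derivative F (at (coords c m0)) (X m0 c) = 0"
      proof (rule derivative_eq_0_on_supp[OF c F(1), of K])
        show "compact K" by (simp add: K_def)
        show "K \<subseteq> coords c ` (U \<inter> chart_dom c)" using Ka a by blast
        show "z \<in> K" if "F z \<noteq> 0" for z using F(2)[OF that] by (simp add: K_def)
        show "frechet_derivative F (at z) v = 0" if "z \<notin> K" for z v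
          using that by (intro F(4)) (simp add: K_def)
        show "0 \<le> frechet_derivative F (at (coords c m)) (X m c)"
          if m: "m \<in> measure_supp U \<mu> \<inter> chart_dom c" for m
        proof (cases "coords c m \<in> K")
          case True
          then have "dist (coords c m) x < \<rho>" using small by (simp add: K_def dist_commute)
          then have "dist (Z (coords c m)) (Z x) < \<epsilon> / 32" using \<rho>(2)[OF xa] True Ka by blast
          moreover have "\<epsilon> * h < dist (coords c m) (x + h *\<^sub>R Z x)"
            using far m unfolding S_def by force
          ultimately show ?thesis using m by (intro F(3)) (auto simp: Xm dist_norm)
        next
          case False
          then show ?thesis using F(4)[of "coords c m"] by (simp add: K_def)
        qed
      qed (rule m0(1))
      moreover have "0 < frechet_derivative F (at x) (Z x)" by (rule F(5)) (use \<epsilon> in simp)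
      ultimately show False using m0 Xm by simp
    qed
  qed
  moreover have "h0 > 0" using r \<rho>(1) B(1) by (simp add: h0_def)
  ultimately show ?thesis unfolding Z_def by blast
qed

end

section \<open>Nagumo's viability theorem\<close>

lemma euler_sequence:
  fixes Z :: "'e::real_normed_vector \<Rightarrow> 'e"
  assumes x0: "x0 \<in> F" and h: "h > 0" and \<epsilon>: "0 \<le> \<epsilon>" "\<epsilon> \<le> 1" and B0: "0 \<le> B"
    and B: "\<And>x. x \<in> cball x0 r \<Longrightarrow> norm (Z x) \<le> B"
    and step: "\<And>x. x \<in> F \<inter> cball x0 r \<Longrightarrow> \<exists>y\<in>F. dist y (x + h *\<^sub>R Z x) \<le> \<epsilon> * h"
  obtains x :: "nat \<Rightarrow> 'e" where "x 0 = x0"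
    "\<And>k. (B + 1) * (real k * h) \<le> r \<Longrightarrow> x k \<in> F \<inter> cball x0 r"
    "\<And>k. (B + 1) * (real k * h) \<le> r \<Longrightarrow> norm (x (Suc k) - x k - h *\<^sub>R Z (x k)) \<le> \<epsilon> * h"
proof -
  have "\<exists>s. \<forall>x\<in>F \<inter> cball x0 r. s x \<in> F \<and> dist (s x) (x + h *\<^sub>R Z x) \<le> \<epsilon> * h"
    using step by metis
  then obtain s where s: "\<And>x. x \<in> F \<inter> cball x0 r \<Longrightarrow> s x \<in> F"
    "\<And>x. x \<in> F \<inter> cball x0 r \<Longrightarrow> dist (s x) (x + h *\<^sub>R Z x) \<le> \<epsilon> * h" by blast
  define x where "x k = (s ^^ k) x0" for k
  \<comment> \<open>A step has length at most h B + \<epsilon> h, and \<epsilon> \<le> 1, hence the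
    speed bound \<open>B + 1\<close>. The guard keeps the iterates in the ball on which
    \<open>s\<close> is controlled.\<close>
  have *: "x k \<in> F \<and> dist x0 (x k) \<le> (B + 1) * (real k * h)" if "(B + 1) * (real k * h) \<le> r" for k
    using that
  proof (induction k)
    case 0
    then show ?case using x0 by (simp add: x_def)
  next
    case (Suc k)
    have "(B + 1) * (real k * h) \<le> (B + 1) * (real (Suc k) * h)"
      using h B0 by (intro mult_left_mono mult_right_mono) auto
    then have IH: "x k \<in> F" "dist x0 (x k) \<le> (B + 1) * (real k * h)" and c: "x k \<in> F \<inter> cball x0 r"
      using Suc by auto
    have "dist (x k) (x (Suc k)) \<le> dist (x k) (x k + h *\<^sub>R Z (x k)) + dist (x (Suc k)) (x k + h *\<^sub>R Z (x k))"
      by (simp add: dist_triangle2)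
    also have "\<dots> \<le> h * B + \<epsilon> * h"
      using s(2)[OF c] B[of "x k"] c h by (intro add_mono) (auto simp: x_def dist_norm)
    also have "\<dots> \<le> (B + 1) * h" using \<epsilon> h by (auto simp: algebra_simps)
    finally have "dist x0 (x (Suc k)) \<le> (B + 1) * (real k * h) + (B + 1) * h"
      using IH(2) dist_triangle[of x0 "x (Suc k)" "x k"] by linarith
    then show ?case using s(1)[OF c] by (simp add: x_def algebra_simps)
  qed
  show thesis
  proof (rule that[of x])
    show "x 0 = x0" by (simp add: x_def)
    show "x k \<in> F \<inter> cball x0 r" if "(B + 1) * (real k * h) \<le> r" for k
      using *[OF that] that by auto
    then show "norm (x (Suc k) - x k - h *\<^sub>R Z (x k)) \<le> \<epsilon> * h" if "(B + 1) * (real k * h) \<le> r" for k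
      using s(2)[of "x k"] that by (simp add: x_def dist_norm diff_diff_eq)
  qed
qed

text \<open>Telescoping. It serves twice: with \<open>v\<close> zero for the Lipschitz estimate, and
  with the value of the field at the left end for the integrated equation.\<close>

lemma euler_sequence_drift:
  fixes x :: "nat \<Rightarrow> 'e::real_normed_vector"
  assumes "h > 0" "i \<le> j"
    and "\<And>k. i \<le> k \<Longrightarrow> k < j \<Longrightarrow> norm (x (Suc k) - x k - h *\<^sub>R v) \<le> b * h"
  shows "norm (x j - x i - (real (j - i) * h) *\<^sub>R v) \<le> b * (real (j - i) * h)"
  using assms(2,3)
proof (induction j rule: dec_induct)
  case (step j)
  have "x (Suc j) - x i - (real (Suc j - i) * h) *\<^sub>R v
      = (x j - x i - (real (j - i) * h) *\<^sub>R v) + (x (Suc j) - x j - h *\<^sub>R v)"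
    using step(1) by (simp add: Suc_diff_le algebra_simps)
  then have "norm (x (Suc j) - x i - (real (Suc j - i) * h) *\<^sub>R v)
      \<le> norm (x j - x i - (real (j - i) * h) *\<^sub>R v) + norm (x (Suc j) - x j - h *\<^sub>R v)"
    using norm_triangle_ineq by metis
  also have "\<dots> \<le> b * (real (j - i) * h) + b * h"
    using step by (intro add_mono) auto
  finally show ?case using step(1) by (simp add: Suc_diff_le algebra_simps)
qed simp

text \<open>The iterates are interpolated by constants rather than chords, since a chord may leave
  \<open>F\<close>. The price is a rounding of times by up to \<open>h\<close>, visible in the
  summands \<open>h\<close> and \<open>h * B\<close>. The numbers \<open>d\<close> and
  \<open>e\<close>, a modulus of continuity of \<open>Z\<close>, are quantified after
  \<open>g\<close>, so that one scheme satisfies the estimate for every precision.\<close>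

lemma euler_step_function:
  fixes Z :: "'e::real_normed_vector \<Rightarrow> 'e"
  assumes x0: "x0 \<in> F" and h: "h > 0" and \<epsilon>: "0 \<le> \<epsilon>" "\<epsilon> \<le> 1" and B0: "0 \<le> B" and r: "0 < r"
    and B: "\<And>x. x \<in> cball x0 r \<Longrightarrow> norm (Z x) \<le> B"
    and step: "\<And>x. x \<in> F \<inter> cball x0 r \<Longrightarrow> \<exists>y\<in>F. dist y (x + h *\<^sub>R Z x) \<le> \<epsilon> * h"
  obtains g :: "real \<Rightarrow> 'e" where "g 0 = x0" "\<And>t. g t \<in> F \<inter> cball x0 r"
    "\<And>s t. 0 \<le> s \<Longrightarrow> s \<le> t \<Longrightarrow> t \<le> r / (B + 1) \<Longrightarrow> norm (g t - g s) \<le> (B + 1) * (t - s + h)"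
    "\<And>s t e d. 0 \<le> s \<Longrightarrow> s \<le> t \<Longrightarrow> t \<le> r / (B + 1) \<Longrightarrow> (B + 1) * (t - s + h) \<le> d \<Longrightarrow> 0 \<le> e \<Longrightarrow>
      (\<And>x y. x \<in> F \<inter> cball x0 r \<Longrightarrow> y \<in> F \<inter> cball x0 r \<Longrightarrow> dist x y \<le> d \<Longrightarrow> norm (Z x - Z y) \<le> e) \<Longrightarrow>
      norm (g t - g s - (t - s) *\<^sub>R Z (g s)) \<le> (\<epsilon> + e) * (t - s + h) + h * B"
proof -
  obtain x where x: "x 0 = x0"
    "\<And>k. (B + 1) * (real k * h) \<le> r \<Longrightarrow> x k \<in> F \<inter> cball x0 r"
    "\<And>k. (B + 1) * (real k * h) \<le> r \<Longrightarrow> norm (x (Suc k) - x k - h *\<^sub>R Z (x k)) \<le> \<epsilon> * h"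
    using euler_sequence[OF x0 h \<epsilon> B0 B step] by blast
  define T where "T = r / (B + 1)"
  have T: "T > 0" using r B0 by (simp add: T_def)
  define k where "k t = nat \<lfloor>t / h\<rfloor>" for t :: real
  have k: "real (k t) * h \<le> t" "t < real (k t) * h + h" if "0 \<le> t" for t
  proof -
    have "real (k t) = of_int \<lfloor>t / h\<rfloor>" using that h by (simp add: k_def)
    then show "real (k t) * h \<le> t" "t < real (k t) * h + h"
      using floor_divide_lower[OF h, of t] floor_divide_upper[OF h, of t] by (simp_all add: algebra_simps)
  qed
  have kT: "(B + 1) * (real j * h) \<le> r" if "j \<le> k t" "0 \<le> t" "t \<le> T" for t j
  proof -
    have "real j * h \<le> real (k t) * h" using that h by (intro mult_right_mono) auto
    then have "real j * h \<le> T" using k(1)[of t] that by linarith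
    then show ?thesis using B0 by (simp add: T_def field_simps)
  qed
  have k_mono: "k s \<le> k t" if "s \<le> t" for s t
    unfolding k_def using that h by (intro nat_mono floor_mono divide_right_mono) auto
  have Lip: "norm (x j - x i) \<le> (B + 1) * (real (j - i) * h)" if "i \<le> j" "j \<le> k t" "0 \<le> t" "t \<le> T" for i j t
  proof -
    have "norm (x (Suc l) - x l - h *\<^sub>R 0) \<le> (B + 1) * h" if "l < j" for l
    proof -
      have l: "(B + 1) * (real l * h) \<le> r" using kT[of l t] that \<open>j \<le> k t\<close> \<open>0 \<le> t\<close> \<open>t \<le> T\<close> by simp
      have "norm (x (Suc l) - x l) \<le> norm (x (Suc l) - x l - h *\<^sub>R Z (x l)) + norm (h *\<^sub>R Z (x l))"
        by (metis diff_add_cancel norm_triangle_ineq)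
      also have "\<dots> \<le> \<epsilon> * h + h * B"
        using x(3)[OF l] x(2)[OF l] B[of "x l"] h by (intro add_mono) auto
      also have "\<dots> \<le> (B + 1) * h" using \<epsilon> h by (auto simp: algebra_simps)
      finally show ?thesis by simp
    qed
    then have "norm (x j - x i - (real (j - i) * h) *\<^sub>R 0) \<le> (B + 1) * (real (j - i) * h)"
      by (intro euler_sequence_drift h that)
    then show ?thesis by simp
  qed
  \<comment> \<open>The default \<open>x0\<close> keeps all values in
    \<open>F \<inter> cball x0 r\<close>, at all real times; \<open>viable_curve\<close> needs this
    to place the schemes in a product of compact sets.\<close>
  define g where "g t = (if 0 \<le> t \<and> t \<le> T then x (k t) else x0)" for t
  have gap: "real (k t - k s) * h \<le> t - s + h" "\<bar>t - s - real (k t - k s) * h\<bar> \<le> h" if "0 \<le> s" "s \<le> t" for s t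
    using k[of s] k[of t] k_mono[OF that(2)] that by (auto simp: of_nat_diff algebra_simps)
  show thesis
  proof (rule that[of g])
    show "g 0 = x0" using T x(1) by (simp add: g_def k_def)
    show "g t \<in> F \<inter> cball x0 r" for t
      using x(2)[OF kT[of "k t" t]] x0 r by (auto simp: g_def)
    fix s t :: real assume st: "0 \<le> s" "s \<le> t" "t \<le> r / (B + 1)"
    then have g: "g s = x (k s)" "g t = x (k t)" by (auto simp: g_def T_def)
    note km = k_mono[OF st(2)]
    show "norm (g t - g s) \<le> (B + 1) * (t - s + h)"
    proof -
      have "norm (g t - g s) \<le> (B + 1) * (real (k t - k s) * h)"
        unfolding g using st by (intro Lip[OF km]) (auto simp: T_def)
      also have "\<dots> \<le> (B + 1) * (t - s + h)" using gap st B0 by (intro mult_left_mono) auto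
      finally show ?thesis .
    qed
    fix e d :: real assume d: "(B + 1) * (t - s + h) \<le> d" and e: "0 \<le> e"
      and Z: "\<And>x y. x \<in> F \<inter> cball x0 r \<Longrightarrow> y \<in> F \<inter> cball x0 r \<Longrightarrow> dist x y \<le> d \<Longrightarrow> norm (Z x - Z y) \<le> e"
    have "norm (x (Suc l) - x l - h *\<^sub>R Z (g s)) \<le> (\<epsilon> + e) * h" if l: "k s \<le> l" "l < k t" for l
    proof -
      have lT: "(B + 1) * (real l * h) \<le> r" "(B + 1) * (real (k s) * h) \<le> r"
        using kT[of _ t] l st by (auto simp: T_def)
      have "norm (x l - x (k s)) \<le> (B + 1) * (real (l - k s) * h)"
        using l st by (intro Lip[of _ _ t]) (auto simp: T_def)
      also have "\<dots> \<le> (B + 1) * (real (k t - k s) * h)"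
        using l h B0 by (intro mult_left_mono mult_right_mono) auto
      also have "\<dots> \<le> (B + 1) * (t - s + h)" using gap st B0 by (intro mult_left_mono) auto
      finally have "norm (Z (x l) - Z (x (k s))) \<le> e"
        using d x(2)[OF lT(1)] x(2)[OF lT(2)] by (intro Z) (auto simp: dist_norm)
      then have "norm (h *\<^sub>R (Z (x l) - Z (x (k s)))) \<le> h * e" using h by simp
      moreover have "x (Suc l) - x l - h *\<^sub>R Z (g s)
          = (x (Suc l) - x l - h *\<^sub>R Z (x l)) + h *\<^sub>R (Z (x l) - Z (x (k s)))"
        by (simp add: g algebra_simps)
      ultimately have "norm (x (Suc l) - x l - h *\<^sub>R Z (g s)) \<le> \<epsilon> * h + h * e"
        using x(3)[OF lT(1)] norm_triangle_mono by metis
      then show ?thesis by (simp add: algebra_simps)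
    qed
    then have "norm (x (k t) - x (k s) - (real (k t - k s) * h) *\<^sub>R Z (g s)) \<le> (\<epsilon> + e) * (real (k t - k s) * h)"
      by (intro euler_sequence_drift h km)
    also have "\<dots> \<le> (\<epsilon> + e) * (t - s + h)" using gap st \<epsilon> e by (intro mult_left_mono) auto
    finally have 1: "norm (g t - g s - (real (k t - k s) * h) *\<^sub>R Z (g s)) \<le> (\<epsilon> + e) * (t - s + h)"
      by (simp add: g)
    have "g s \<in> F \<inter> cball x0 r" using x(2)[OF kT[of "k s" s]] st by (auto simp: g T_def)
    then have "\<bar>t - s - real (k t - k s) * h\<bar> * norm (Z (g s)) \<le> h * B"
      using gap(2)[OF st(1,2)] B[of "g s"] h by (intro mult_mono) auto
    then have 2: "norm ((t - s - real (k t - k s) * h) *\<^sub>R Z (g s)) \<le> h * B" by simp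
    have eq: "g t - g s - (t - s) *\<^sub>R Z (g s) = (g t - g s - (real (k t - k s) * h) *\<^sub>R Z (g s))
        - (t - s - real (k t - k s) * h) *\<^sub>R Z (g s)"
      by (simp add: algebra_simps)
    show "norm (g t - g s - (t - s) *\<^sub>R Z (g s)) \<le> (\<epsilon> + e) * (t - s + h) + h * B"
      unfolding eq by (rule order_trans[OF norm_triangle_ineq4 add_mono[OF 1 2]])
  qed
qed

section \<open>Passage to the limit\<close>

lemma drift_imp_has_vector_derivative:
  fixes \<gamma> Y :: "real \<Rightarrow> 'e::real_normed_vector"
  assumes drift: "\<And>e. e > 0 \<Longrightarrow> \<exists>d>0. \<forall>s\<in>S. \<forall>t\<in>S. s \<le> t \<longrightarrow> t - s < d \<longrightarrow>
      norm (\<gamma> t - \<gamma> s - (t - s) *\<^sub>R Y s) \<le> e * (t - s)"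
    and Y: "continuous_on S Y" and t: "t \<in> S"
  shows "(\<gamma> has_vector_derivative Y t) (at t within S)"
  unfolding has_vector_derivative_def has_derivative_within_alt
proof (intro conjI allI impI)
  show "bounded_linear (\<lambda>s. s *\<^sub>R Y t)" by (rule bounded_linear_scaleR_left)
  fix e :: real assume e: "e > 0"
  then have e2: "e / 2 > 0" by simp
  obtain d1 where d1: "d1 > 0" "\<And>s t. s \<in> S \<Longrightarrow> t \<in> S \<Longrightarrow> s \<le> t \<Longrightarrow> t - s < d1 \<Longrightarrow>
      norm (\<gamma> t - \<gamma> s - (t - s) *\<^sub>R Y s) \<le> e / 2 * (t - s)"
    using drift[OF e2] by blast
  obtain d2 where d2: "d2 > 0" "\<And>s. s \<in> S \<Longrightarrow> dist s t < d2 \<Longrightarrow> dist (Y s) (Y t) < e / 2"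
    using Y t e2 unfolding continuous_on_iff by blast
  show "\<exists>d>0. \<forall>s\<in>S. norm (s - t) < d \<longrightarrow> norm (\<gamma> s - \<gamma> t - (s - t) *\<^sub>R Y t) \<le> e * norm (s - t)"
  proof (intro exI[of _ "min d1 d2"] conjI ballI impI)
    fix s assume s: "s \<in> S" "norm (s - t) < min d1 d2"
    show "norm (\<gamma> s - \<gamma> t - (s - t) *\<^sub>R Y t) \<le> e * norm (s - t)"
    proof (cases "t \<le> s")
      case True
      then have "norm (\<gamma> s - \<gamma> t - (s - t) *\<^sub>R Y t) \<le> e / 2 * (s - t)"
        using d1(2)[OF t s(1)] s(2) by simp
      also have "\<dots> \<le> e * norm (s - t)" using True e by simp
      finally show ?thesis .
    next
      \<comment> \<open>\<open>drift\<close> takes the field at the left end of the time interval,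
        which here is \<open>s\<close>. Continuity of \<open>Y\<close> replaces \<open>Y s\<close>
        by \<open>Y t\<close>; each of the two errors takes half of \<open>e\<close>.\<close>
      case False
      have 1: "norm (\<gamma> t - \<gamma> s - (t - s) *\<^sub>R Y s) \<le> e / 2 * (t - s)"
        using d1(2)[OF s(1) t] s(2) False by simp
      have "norm (Y s - Y t) < e / 2" using d2(2)[OF s(1)] s(2) by (simp add: dist_norm)
      then have 2: "norm ((t - s) *\<^sub>R (Y s - Y t)) \<le> (t - s) * (e / 2)"
        using False by (simp add: mult_left_mono)
      have eq: "\<gamma> s - \<gamma> t - (s - t) *\<^sub>R Y t
          = - (\<gamma> t - \<gamma> s - (t - s) *\<^sub>R Y s) - (t - s) *\<^sub>R (Y s - Y t)"
        by (simp add: algebra_simps)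
      have "norm (\<gamma> s - \<gamma> t - (s - t) *\<^sub>R Y t) \<le> e / 2 * (t - s) + (t - s) * (e / 2)"
        unfolding eq by (rule order_trans[OF norm_triangle_ineq4 add_mono[OF _ 2]]) (use 1 in \<open>simp add: norm_minus_commute\<close>)
      also have "\<dots> = e * norm (s - t)" using False by simp
      finally show ?thesis .
    qed
  qed (use d1 d2 in auto)
qed

text \<open>Nagumo's theorem. The Euler step functions need not be equicontinuous, but the integrated
  form of the equation passes to any cluster point in the topology of pointwise convergence, which
  exists by Tychonoff's theorem.\<close>

lemma viable_curve:
  fixes Z :: "'e::euclidean_space \<Rightarrow> 'e"
  assumes x0: "x0 \<in> F" and r: "r > 0" and F: "closed (F \<inter> cball x0 r)"
    and Z: "continuous_on (cball x0 r) Z"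
    and step: "\<And>\<epsilon>. \<epsilon> > 0 \<Longrightarrow> \<exists>h0>0. \<forall>h x. 0 < h \<longrightarrow> h < h0 \<longrightarrow> x \<in> F \<inter> cball x0 r \<longrightarrow>
      (\<exists>y\<in>F. dist y (x + h *\<^sub>R Z x) \<le> \<epsilon> * h)"
  obtains T \<gamma> where "T > 0" "\<gamma> 0 = x0" "\<And>t. \<gamma> t \<in> F \<inter> cball x0 r"
    "\<And>t. t \<in> {0..T} \<Longrightarrow> (\<gamma> has_vector_derivative Z (\<gamma> t)) (at t within {0..T})"
proof -
  define K where "K = F \<inter> cball x0 r"
  have "compact K" unfolding K_def using F by (simp add: compact_eq_bounded_closed bounded_Int)
  have Zu: "uniformly_continuous_on (cball x0 r) Z"
    using Z by (intro compact_uniformly_continuous) auto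
  have "bounded (Z ` cball x0 r)"
    using Z by (intro compact_imp_bounded compact_continuous_image) auto
  then obtain B where "0 < B" "\<And>x. x \<in> cball x0 r \<Longrightarrow> norm (Z x) \<le> B"
    unfolding bounded_pos by blast
  then have B: "0 \<le> B" "\<And>x. x \<in> cball x0 r \<Longrightarrow> norm (Z x) \<le> B" by auto
  define T where "T = r / (B + 1)"
  have T: "T > 0" using r B by (simp add: T_def)
  define \<epsilon> where "\<epsilon> n = inverse (real (Suc n))" for n
  have \<epsilon>: "0 < \<epsilon> n" "\<epsilon> n \<le> 1" for n by (auto simp: \<epsilon>_def field_simps)
  have "\<exists>h g. 0 < h \<and> h \<le> \<epsilon> n \<and> g 0 = x0 \<and> (\<forall>t. g t \<in> K) \<and>
      (\<forall>s t. 0 \<le> s \<longrightarrow> s \<le> t \<longrightarrow> t \<le> T \<longrightarrow> norm (g t - g s) \<le> (B + 1) * (t - s + h)) \<and>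
      (\<forall>s t e d. 0 \<le> s \<longrightarrow> s \<le> t \<longrightarrow> t \<le> T \<longrightarrow> (B + 1) * (t - s + h) \<le> d \<longrightarrow> 0 \<le> e \<longrightarrow>
        (\<forall>x y. x \<in> K \<longrightarrow> y \<in> K \<longrightarrow> dist x y \<le> d \<longrightarrow> norm (Z x - Z y) \<le> e) \<longrightarrow>
        norm (g t - g s - (t - s) *\<^sub>R Z (g s)) \<le> (\<epsilon> n + e) * (t - s + h) + h * B)" for n
  proof -
    obtain h0 where h0: "h0 > 0" "\<And>h x. 0 < h \<Longrightarrow> h < h0 \<Longrightarrow> x \<in> F \<inter> cball x0 r \<Longrightarrow>
        \<exists>y\<in>F. dist y (x + h *\<^sub>R Z x) \<le> \<epsilon> n * h"
      using step[OF \<epsilon>(1)[of n]] by blast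
    define h where "h = min (h0 / 2) (\<epsilon> n)"
    have h: "0 < h" "h < h0" "h \<le> \<epsilon> n" using h0(1) \<epsilon>(1)[of n] by (auto simp: h_def)
    obtain g where "g 0 = x0" "\<And>t. g t \<in> F \<inter> cball x0 r"
      "\<And>s t. 0 \<le> s \<Longrightarrow> s \<le> t \<Longrightarrow> t \<le> r / (B + 1) \<Longrightarrow> norm (g t - g s) \<le> (B + 1) * (t - s + h)"
      "\<And>s t e d. 0 \<le> s \<Longrightarrow> s \<le> t \<Longrightarrow> t \<le> r / (B + 1) \<Longrightarrow> (B + 1) * (t - s + h) \<le> d \<Longrightarrow> 0 \<le> e \<Longrightarrow>
        (\<And>x y. x \<in> F \<inter> cball x0 r \<Longrightarrow> y \<in> F \<inter> cball x0 r \<Longrightarrow> dist x y \<le> d \<Longrightarrow> norm (Z x - Z y) \<le> e) \<Longrightarrow>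
        norm (g t - g s - (t - s) *\<^sub>R Z (g s)) \<le> (\<epsilon> n + e) * (t - s + h) + h * B"
      by (rule euler_step_function[OF x0 h(1) less_imp_le[OF \<epsilon>(1)] \<epsilon>(2)[of n] B(1) r B(2) h0(2)[OF h(1,2)]])
        blast+
    then show ?thesis using h(1,3) unfolding K_def T_def
      by (intro exI[of _ h] exI[of _ g] conjI allI impI) blast+
  qed
  then obtain h g where h: "\<And>n. 0 < h n" "\<And>n. h n \<le> \<epsilon> n" and g0: "\<And>n. g n 0 = x0"
    and gK: "\<And>n t. g n t \<in> K"
    and Lip: "\<And>n s t. 0 \<le> s \<Longrightarrow> s \<le> t \<Longrightarrow> t \<le> T \<Longrightarrow> norm (g n t - g n s) \<le> (B + 1) * (t - s + h n)"
    and drift: "\<And>n s t e d. 0 \<le> s \<Longrightarrow> s \<le> t \<Longrightarrow> t \<le> T \<Longrightarrow> (B + 1) * (t - s + h n) \<le> d \<Longrightarrow> 0 \<le> e \<Longrightarrow>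
        (\<forall>x y. x \<in> K \<longrightarrow> y \<in> K \<longrightarrow> dist x y \<le> d \<longrightarrow> norm (Z x - Z y) \<le> e) \<Longrightarrow>
        norm (g n t - g n s - (t - s) *\<^sub>R Z (g n s)) \<le> (\<epsilon> n + e) * (t - s + h n) + h n * B"
    by metis
  have \<epsilon>_lim: "\<epsilon> \<longlonglongrightarrow> 0" unfolding \<epsilon>_def by (rule LIMSEQ_inverse_real_of_nat)
  have h_lim: "h \<longlonglongrightarrow> 0"
    by (rule tendsto_sandwich[OF _ _ tendsto_const \<epsilon>_lim]) (use h in \<open>auto intro: always_eventually less_imp_le\<close>)
  define C where "C = PiE UNIV (\<lambda>_::real. K)"
  have "compact C"
    using compactin_PiE[of "\<lambda>_. euclidean" UNIV "\<lambda>_::real. K"] \<open>compact K\<close>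
    by (simp add: C_def euclidean_product_topology)
  moreover have "filtermap g sequentially \<noteq> bot" by (simp add: filtermap_bot_iff)
  moreover have "eventually (\<lambda>f. f \<in> C) (filtermap g sequentially)"
    using gK by (simp add: eventually_filtermap C_def PiE_UNIV_domain)
  ultimately obtain \<gamma> where \<gamma>: "\<gamma> \<in> C" and ne: "inf (nhds \<gamma>) (filtermap g sequentially) \<noteq> bot"
    unfolding compact_filter by blast
  \<comment> \<open>The space of all functions on the reals is not first countable, so a cluster
    point need not be the limit of a subsequence. Limits are taken along this filter
    instead.\<close>
  define \<F> where "\<F> = inf (nhds \<gamma>) (filtermap g sequentially)"
  have ev: "eventually P \<F>" if "eventually (\<lambda>n. P (g n)) sequentially" for P
    using that unfolding \<F>_def by (auto intro: filter_leD[OF inf_le2] simp: eventually_filtermap)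
  have tend: "((\<lambda>f. f t) \<longlongrightarrow> \<gamma> t) \<F>" for t
  proof -
    have "((\<lambda>f. f t) \<longlongrightarrow> \<gamma> t) (nhds \<gamma>)"
    proof (rule topological_tendstoI)
      fix S assume S: "open S" "\<gamma> t \<in> S"
      then have "open ((\<lambda>f::real \<Rightarrow> 'e. f t) -` S)" by (intro open_vimage) simp_all
      then show "eventually (\<lambda>f. f t \<in> S) (nhds \<gamma>)" unfolding eventually_nhds using S(2) by blast
    qed
    then show ?thesis unfolding \<F>_def by (rule tendsto_mono[OF inf_le1])
  qed
  have \<gamma>K: "\<gamma> t \<in> K" for t using \<gamma> by (auto simp: C_def)
  have le_limit: "norm p \<le> b" if "((\<lambda>f. P f) \<longlongrightarrow> p) \<F>" "b' \<longlonglongrightarrow> b"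
    "eventually (\<lambda>n. norm (P (g n)) \<le> b' n) sequentially" for P and p :: 'e and b' b
  proof (rule field_le_epsilon)
    \<comment> \<open>The filter lives on functions and does not see the index, so the bound
      \<open>b' n\<close> is first replaced by the constant \<open>b + e\<close>.\<close>
    fix e :: real assume "e > 0"
    then have "eventually (\<lambda>n. b' n < b + e) sequentially"
      using order_tendstoD(2)[OF that(2), of "b + e"] by simp
    with that(3) have "eventually (\<lambda>n. norm (P (g n)) \<le> b + e) sequentially"
      by eventually_elim simp
    then show "norm p \<le> b + e"
      using ne tendsto_norm[OF that(1)] unfolding \<F>_def[symmetric]
      by (intro tendsto_upperbound[OF _ ev]) auto
  qed
  \<comment> \<open>The jumps of \<open>g n\<close> are accounted for by \<open>h n\<close>, which
    tends to 0. So the limit is Lipschitz although the \<open>g n\<close> need not be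
    continuous.\<close>
  have \<gamma>Lip: "norm (\<gamma> t - \<gamma> s) \<le> (B + 1) * (t - s + 0)" if "0 \<le> s" "s \<le> t" "t \<le> T" for s t
    by (rule le_limit[where P = "\<lambda>f. f t - f s" and b' = "\<lambda>n. (B + 1) * (t - s + h n)"];
      (intro tendsto_intros tend h_lim always_eventually allI Lip that)?)
  have cont: "continuous_on {0..T} \<gamma>"
  proof (rule lipschitz_on_continuous_on)
    show "(B + 1)-lipschitz_on {0..T} \<gamma>"
    proof (rule lipschitz_onI)
      show "dist (\<gamma> s) (\<gamma> t) \<le> (B + 1) * dist s t" if "s \<in> {0..T}" "t \<in> {0..T}" for s t
      proof (cases "s \<le> t")
        case True
        then show ?thesis using \<gamma>Lip[of s t] that by (simp add: dist_norm norm_minus_commute)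
      next
        case False
        then show ?thesis using \<gamma>Lip[of t s] that by (simp add: dist_norm norm_minus_commute)
      qed
    qed (use B in simp)
  qed
  have Z_K: "continuous_on K Z" using Z by (rule continuous_on_subset) (auto simp: K_def)
  have Zlim: "((\<lambda>f. Z (f s)) \<longlongrightarrow> Z (\<gamma> s)) \<F>" for s
    by (rule continuous_on_tendsto_compose[OF Z_K tend \<gamma>K ev]) (use gK in auto)
  have "\<exists>d>0. \<forall>s\<in>{0..T}. \<forall>t\<in>{0..T}. s \<le> t \<longrightarrow> t - s < d \<longrightarrow>
      norm (\<gamma> t - \<gamma> s - (t - s) *\<^sub>R Z (\<gamma> s)) \<le> e * (t - s)" if e: "e > 0" for e
  proof -
    obtain d where d: "d > 0" "\<And>x y. x \<in> cball x0 r \<Longrightarrow> y \<in> cball x0 r \<Longrightarrow> dist y x < d \<Longrightarrow> dist (Z y) (Z x) < e"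
      using Zu e unfolding uniformly_continuous_on_def by blast
    have dZ: "\<forall>x y. x \<in> K \<longrightarrow> y \<in> K \<longrightarrow> dist x y \<le> d / 2 \<longrightarrow> norm (Z x - Z y) \<le> e"
      using d by (force simp: K_def dist_norm)
    show ?thesis
    proof (intro exI[of _ "d / 2 / (B + 1)"] conjI ballI impI)
      show "d / 2 / (B + 1) > 0" using d B by simp
      fix s t assume st: "s \<in> {0..T}" "t \<in> {0..T}" "s \<le> t" "t - s < d / 2 / (B + 1)"
      have "(B + 1) * (t - s + 0) < d / 2" using st(4) B by (simp add: field_simps)
      moreover have "(\<lambda>n. (B + 1) * (t - s + h n)) \<longlonglongrightarrow> (B + 1) * (t - s + 0)"
        by (intro tendsto_intros h_lim)
      ultimately have "eventually (\<lambda>n. (B + 1) * (t - s + h n) < d / 2) sequentially"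
        using order_tendstoD(2) by blast
      then have "eventually (\<lambda>n. norm (g n t - g n s - (t - s) *\<^sub>R Z (g n s)) \<le>
          (\<epsilon> n + e) * (t - s + h n) + h n * B) sequentially"
        by eventually_elim (use drift[OF _ _ _ _ _ dZ] st e in auto)
      then have "norm (\<gamma> t - \<gamma> s - (t - s) *\<^sub>R Z (\<gamma> s)) \<le> (0 + e) * (t - s + 0) + 0 * B"
        by (intro le_limit[where P = "\<lambda>f. f t - f s - (t - s) *\<^sub>R Z (f s)"
              and b' = "\<lambda>n. (\<epsilon> n + e) * (t - s + h n) + h n * B"]; (intro tendsto_intros tend Zlim h_lim \<epsilon>_lim)?)
      then show "norm (\<gamma> t - \<gamma> s - (t - s) *\<^sub>R Z (\<gamma> s)) \<le> e * (t - s)" by simp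
    qed
  qed
  moreover have "continuous_on {0..T} (\<lambda>t. Z (\<gamma> t))"
    using continuous_on_compose2[OF Z_K cont] \<gamma>K by blast
  ultimately have "(\<gamma> has_vector_derivative Z (\<gamma> t)) (at t within {0..T})" if "t \<in> {0..T}" for t
    using that by (rule drift_imp_has_vector_derivative)
  moreover have "\<gamma> 0 = x0"
    using le_limit[OF tendsto_diff[OF tend[of 0] tendsto_const[of x0]] tendsto_const[of 0]] g0 by simp
  ultimately show thesis using that T \<gamma>K unfolding K_def by blast
qed

section \<open>Maximal integral curves inside a closed set\<close>

lemma has_derivative_within_Un:
  assumes "(f has_derivative f') (at x within S)" "(f has_derivative f') (at x within T)"
  shows "(f has_derivative f') (at x within S \<union> T)"
  using assms unfolding has_derivative_within by (simp add: at_within_union filterlim_sup)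

context continuous_vf
begin

lemma integral_curveD:
  assumes "integral_curve A U X I \<gamma>"
  shows "is_interval I" "I \<noteq> {}" "continuous_on I \<gamma>" "\<gamma> ` I \<subseteq> U"
    "\<And>c s. c \<in> A \<Longrightarrow> s \<in> I \<Longrightarrow> \<gamma> s \<in> chart_dom c \<Longrightarrow>
      ((\<lambda>t. coords c (\<gamma> t)) has_vector_derivative X (\<gamma> s) c) (at s within I)"
  using assms unfolding integral_curve_def C1_curve_def has_velocity_def by blast+

text \<open>The chain rule for a transition map. Values of \<open>coords c\<close> outside the chart
  are arbitrary; continuity of the curve ensures that it stays in the domain of \<open>c\<close> at
  times near \<open>s\<close>.\<close>

lemma has_vector_derivative_chart_change:
  assumes cd: "c \<in> A" "d \<in> A" and s: "s \<in> I" "\<gamma> s \<in> chart_dom c" "\<gamma> s \<in> chart_dom d" "\<gamma> s \<in> U"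
    and cont: "continuous (at s within I) \<gamma>"
    and der: "((\<lambda>t. coords c (\<gamma> t)) has_vector_derivative X (\<gamma> s) c) (at s within I)"
  shows "((\<lambda>t. coords d (\<gamma> t)) has_vector_derivative X (\<gamma> s) d) (at s within I)"
proof -
  let ?T = "coords d \<circ> param c"
  define T' where "T' = frechet_derivative ?T (at (coords c (\<gamma> s)))"
  have T: "(?T has_derivative T') (at (coords c (\<gamma> s)))"
    unfolding T'_def using transition_has_derivative[OF cd s(2,3)] .
  have "((\<lambda>t. ?T (coords c (\<gamma> t))) has_derivative (\<lambda>h. T' (h *\<^sub>R X (\<gamma> s) c))) (at s within I)"
    using has_derivative_compose[OF der[unfolded has_vector_derivative_def] T] .
  moreover have "T' (h *\<^sub>R X (\<gamma> s) c) = h *\<^sub>R X (\<gamma> s) d" for h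
    using linear_cmul[OF has_derivative_linear[OF T]] X_transition[OF cd s(4,2,3)] by (simp add: T'_def)
  ultimately have "((\<lambda>t. ?T (coords c (\<gamma> t))) has_derivative (\<lambda>h. h *\<^sub>R X (\<gamma> s) d)) (at s within I)"
    by simp
  moreover have "eventually (\<lambda>t. \<gamma> t \<in> chart_dom c) (at s within I)"
    using topological_tendstoD[OF cont[unfolded continuous_within] open_chart_dom[OF cd(1)] s(2)] .
  then have "eventually (\<lambda>t. ?T (coords c (\<gamma> t)) = coords d (\<gamma> t)) (at s within I)"
    by eventually_elim (use chart_inverse(1)[OF chart[OF cd(1)]] in simp)
  ultimately show ?thesis unfolding has_vector_derivative_def
    by (rule has_derivative_transform_eventually) (use s chart_inverse(1)[OF chart[OF cd(1)]] in auto)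
qed

text \<open>By the change of charts the velocity has to be verified in one chart at each time only,
  and \<open>C1_curve\<close> follows because \<open>X\<close> is continuous along the
  curve.\<close>

lemma integral_curveI:
  assumes "is_interval I" "I \<noteq> {}" "\<gamma> ` I \<subseteq> U"
    and cont: "\<And>s. s \<in> I \<Longrightarrow> continuous (at s within I) \<gamma>"
    and der: "\<And>s. s \<in> I \<Longrightarrow> \<exists>c\<in>A. \<gamma> s \<in> chart_dom c \<and>
      ((\<lambda>t. coords c (\<gamma> t)) has_vector_derivative X (\<gamma> s) c) (at s within I)"
  shows "integral_curve A U X I \<gamma>"
proof -
  have vel: "has_velocity A I \<gamma> s (X (\<gamma> s))" if "s \<in> I" for s
    unfolding has_velocity_def
    using der[OF that] has_vector_derivative_chart_change cont[OF that] that assms(3) by blast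
  have cont': "continuous_on I \<gamma>" using cont by (simp add: continuous_on_eq_continuous_within)
  have "continuous_on {s \<in> I. \<gamma> s \<in> chart_dom c} (\<lambda>s. X (\<gamma> s) c)" if "c \<in> A" for c
    by (rule continuous_on_compose2[OF continuous_X[OF that] continuous_on_subset[OF cont']])
      (use assms(3) in auto)
  then have "C1_curve A I \<gamma>"
    unfolding C1_curve_def using cont' vel by (intro conjI exI[of _ "\<lambda>s. X (\<gamma> s)"]) auto
  then show ?thesis unfolding integral_curve_def using assms vel by blast
qed

text \<open>Makes unions of chains of curves work: near each time, one member of the chain describes
  the whole curve. Restriction to a smaller interval is the case of a single
  \<open>J\<close>.\<close>

lemma integral_curve_locally:
  assumes "is_interval I" "I \<noteq> {}"
    and loc: "\<And>s. s \<in> I \<Longrightarrow> \<exists>J \<delta> e. integral_curve A U X J \<delta> \<and> e > 0 \<and> I \<inter> ball s e \<subseteq> J \<and>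
      (\<forall>t\<in>I \<inter> ball s e. \<delta> t = \<gamma> t)"
  shows "integral_curve A U X I \<gamma>"
proof -
  have "\<gamma> s \<in> U \<and> continuous (at s within I) \<gamma> \<and> (\<exists>c\<in>A. \<gamma> s \<in> chart_dom c \<and>
      ((\<lambda>t. coords c (\<gamma> t)) has_vector_derivative X (\<gamma> s) c) (at s within I))" if s: "s \<in> I" for s
  proof -
    obtain J \<delta> e where J: "integral_curve A U X J \<delta>" "e > 0" "I \<inter> ball s e \<subseteq> J"
      and \<delta>: "\<And>t. t \<in> I \<inter> ball s e \<Longrightarrow> \<delta> t = \<gamma> t" using loc[OF s] by blast
    note JD = integral_curveD[OF J(1)]
    have sJ: "s \<in> J" "\<delta> s = \<gamma> s" using J \<delta> s by auto
    have nhd: "at s within I = at s within I \<inter> ball s e"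
      using J(2) by (intro at_within_nhd[of _ "ball s e"]) auto
    have ev: "eventually (\<lambda>t. \<delta> t = \<gamma> t) (at s within I)"
      unfolding nhd using \<delta> by (auto simp: eventually_at_filter)
    have sub: "at s within I \<le> at s within J" unfolding nhd using J(3) by (rule at_le)
    obtain c where c: "c \<in> A" "\<gamma> s \<in> chart_dom c" by (rule obtain_chart)
    have "(\<delta> \<longlongrightarrow> \<gamma> s) (at s within J)"
      using JD(3) sJ by (auto simp: continuous_on_def)
    then have "(\<delta> \<longlongrightarrow> \<gamma> s) (at s within I)" by (rule tendsto_mono[OF sub])
    then have "(\<gamma> \<longlongrightarrow> \<gamma> s) (at s within I)" by (rule Lim_transform_eventually[OF _ ev])
    moreover have "((\<lambda>t. coords c (\<delta> t)) has_derivative (\<lambda>h. h *\<^sub>R X (\<gamma> s) c)) (at s within I \<inter> ball s e)"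
      using JD(5)[OF c(1) sJ(1)] c(2) sJ(2) J(3) unfolding has_vector_derivative_def
      by (auto intro: has_derivative_subset)
    then have "((\<lambda>t. coords c (\<gamma> t)) has_derivative (\<lambda>h. h *\<^sub>R X (\<gamma> s) c)) (at s within I)"
      unfolding nhd[symmetric]
      by (rule has_derivative_transform_eventually) (use ev sJ s in \<open>auto elim: eventually_mono\<close>)
    ultimately show ?thesis using JD(4) sJ c by (auto simp: continuous_within has_vector_derivative_def)
  qed
  then show ?thesis using assms by (intro integral_curveI) auto
qed

lemma integral_curve_subset:
  assumes "integral_curve A U X J \<delta>" "is_interval I" "I \<noteq> {}" "I \<subseteq> J" "\<And>t. t \<in> I \<Longrightarrow> \<gamma> t = \<delta> t"
  shows "integral_curve A U X I \<gamma>"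
  by (rule integral_curve_locally[OF assms(2,3)])
    (use assms in \<open>intro exI[of _ J] exI[of _ \<delta>] exI[of _ 1]; auto\<close>)

lemma integral_curve_Un:
  assumes "integral_curve A U X I \<gamma>" "integral_curve A U X J \<gamma>" "p \<in> I" "p \<in> J" "I \<subseteq> {..p}" "J \<subseteq> {p..}"
  shows "integral_curve A U X (I \<union> J) \<gamma>"
proof (rule integral_curveI)
  note I = integral_curveD[OF assms(1)] and J = integral_curveD[OF assms(2)]
  show "is_interval (I \<union> J)"
    using connected_Un[of I J] assms(3,4) I(1) J(1) by (auto simp: is_interval_connected_1)
  show "I \<union> J \<noteq> {}" "\<gamma> ` (I \<union> J) \<subseteq> U" using I J by auto
  \<comment> \<open>A time in \<open>J\<close> outside \<open>I\<close> lies beyond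
    \<open>p\<close>, away from the closure of \<open>I\<close>; there \<open>at s within I\<close>
    is \<open>bot\<close> and limits along it hold trivially. Only at \<open>p\<close> are two
    one-sided limits joined, and there both velocities are \<open>X (\<gamma> p)\<close>.\<close>
  have botI: "at s within I = bot" if "s \<notin> I" "s \<in> J" for s
  proof -
    have "closure (I - {s}) \<subseteq> {..p}" using assms(5) by (intro closure_minimal) auto
    moreover have "p < s" using that assms(3,6) by (metis atLeast_iff order_le_less subsetD)
    ultimately show ?thesis unfolding at_within_eq_bot_iff by (meson atMost_iff not_le subsetD)
  qed
  have botJ: "at s within J = bot" if "s \<notin> J" "s \<in> I" for s
  proof -
    have "closure (J - {s}) \<subseteq> {p..}" using assms(6) by (intro closure_minimal) auto
    moreover have "s < p" using that assms(4,5) by (metis atMost_iff order_le_less subsetD)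
    ultimately show ?thesis unfolding at_within_eq_bot_iff by (meson atLeast_iff not_le subsetD)
  qed
  fix s assume s: "s \<in> I \<union> J"
  show "continuous (at s within I \<union> J) \<gamma>"
  proof -
    have "(\<gamma> \<longlongrightarrow> \<gamma> s) (at s within I)"
      using I(3) botI[of s] s by (cases "s \<in> I") (auto simp: continuous_on_def)
    moreover have "(\<gamma> \<longlongrightarrow> \<gamma> s) (at s within J)"
      using J(3) botJ[of s] s by (cases "s \<in> J") (auto simp: continuous_on_def)
    ultimately show ?thesis unfolding continuous_within unfolding at_within_union by (rule filterlim_sup)
  qed
  obtain c where c: "c \<in> A" "\<gamma> s \<in> chart_dom c" by (rule obtain_chart)
  have "((\<lambda>t. coords c (\<gamma> t)) has_derivative (\<lambda>h. h *\<^sub>R X (\<gamma> s) c)) (at s within I)"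
    using I(5)[OF c(1) _ c(2)] botI[of s] s
    by (cases "s \<in> I") (auto simp: has_vector_derivative_def has_derivative_within bounded_linear_scaleR_left)
  moreover have "((\<lambda>t. coords c (\<gamma> t)) has_derivative (\<lambda>h. h *\<^sub>R X (\<gamma> s) c)) (at s within J)"
    using J(5)[OF c(1) _ c(2)] botJ[of s] s
    by (cases "s \<in> J") (auto simp: has_vector_derivative_def has_derivative_within bounded_linear_scaleR_left)
  ultimately have "((\<lambda>t. coords c (\<gamma> t)) has_derivative (\<lambda>h. h *\<^sub>R X (\<gamma> s) c)) (at s within I \<union> J)"
    by (rule has_derivative_within_Un)
  then show "\<exists>c\<in>A. \<gamma> s \<in> chart_dom c \<and>
      ((\<lambda>t. coords c (\<gamma> t)) has_vector_derivative X (\<gamma> s) c) (at s within I \<union> J)"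
    using c unfolding has_vector_derivative_def by blast
qed

lemma integral_curve_in_chart:
  assumes c: "c \<in> A" and I: "is_interval I" "I \<noteq> {}" and y: "\<And>t. t \<in> I \<Longrightarrow> y t \<in> coords c ` (U \<inter> chart_dom c)"
    and der: "\<And>t. t \<in> I \<Longrightarrow> (y has_vector_derivative X (param c (y t)) c) (at t within I)"
  shows "integral_curve A U X I (\<lambda>t. param c (y t))"
proof (rule integral_curveI[OF I])
  note inv = chart_inverse[OF chart[OF c]]
  have yU: "param c (y t) \<in> U \<inter> chart_dom c" "coords c (param c (y t)) = y t" if "t \<in> I" for t
    using y[OF that] inv(1) by auto
  show "(\<lambda>t. param c (y t)) ` I \<subseteq> U" using yU by auto
  fix s assume s: "s \<in> I"
  have "continuous_on I y"
    unfolding continuous_on_eq_continuous_within using has_vector_derivative_continuous[OF der] by blast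
  then have "continuous_on I (\<lambda>t. param c (y t))"
    by (rule continuous_on_compose2[OF chart_continuous(2)[OF chart[OF c]]]) (use y in auto)
  then show "continuous (at s within I) (\<lambda>t. param c (y t))"
    using s by (simp add: continuous_on_eq_continuous_within)
  have "((\<lambda>t. coords c (param c (y t))) has_vector_derivative X (param c (y s)) c) (at s within I)"
    by (rule has_vector_derivative_transform[OF s _ der[OF s]]) (use yU in auto)
  then show "\<exists>d\<in>A. param c (y s) \<in> chart_dom d \<and>
      ((\<lambda>t. coords d (param c (y t))) has_vector_derivative X (param c (y s)) d) (at s within I)"
    using c yU[OF s] by blast
qed

text \<open>A curve in \<open>F\<close> that is maximal among the curves in \<open>F\<close> is maximal among all integral
  curves: an extension would pass through an endpoint, which lies in \<open>F\<close> since \<open>F\<close> is closed, and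
  there the curve could be continued inside \<open>F\<close>.\<close>

lemma maximal_integral_curve_exists:
  assumes F: "F \<subseteq> U" "open (U - F)"
    and fwd: "\<And>m s. m \<in> F \<Longrightarrow> \<exists>T>0. \<exists>\<gamma>. \<gamma> s = m \<and> integral_curve A U X {s..s + T} \<gamma> \<and> \<gamma> ` {s..s + T} \<subseteq> F"
    and bwd: "\<And>m s. m \<in> F \<Longrightarrow> \<exists>T>0. \<exists>\<gamma>. \<gamma> s = m \<and> integral_curve A U X {s - T..s} \<gamma> \<and> \<gamma> ` {s - T..s} \<subseteq> F"
    and m0: "m0 \<in> F"
  obtains I \<gamma> where "0 \<in> I" "\<gamma> 0 = m0" "maximal_integral_curve A U X I \<gamma>" "\<gamma> ` I \<subseteq> F"
proof -
  \<comment> \<open>Functions on the reals are total, so a curve on an interval is encoded by its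
    graph. Extension becomes inclusion, and Zorn's lemma for families of sets applies.\<close>
  define graph :: "real set \<Rightarrow> (real \<Rightarrow> 'a) \<Rightarrow> (real \<times> 'a) set" where "graph I \<gamma> = (\<lambda>s. (s, \<gamma> s)) ` I" for I \<gamma>
  define V where "V I \<gamma> \<longleftrightarrow> 0 \<in> I \<and> \<gamma> 0 = m0 \<and> integral_curve A U X I \<gamma> \<and> \<gamma> ` I \<subseteq> F" for I \<gamma>
  define \<A> where "\<A> = {graph I \<gamma> | I \<gamma>. V I \<gamma>}"
  have mem_graph: "(s, m) \<in> graph I \<gamma> \<longleftrightarrow> s \<in> I \<and> m = \<gamma> s" for s m I \<gamma>
    by (auto simp: graph_def)
  have "\<exists>M\<in>\<A>. \<forall>G\<in>\<A>. M \<subseteq> G \<longrightarrow> G = M"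
  proof (rule subset_Zorn_nonempty)
    obtain T \<gamma> where "T > 0" "\<gamma> 0 = m0" "integral_curve A U X {0..0 + T} \<gamma>" "\<gamma> ` {0..0 + T} \<subseteq> F"
      using fwd[OF m0, of 0] by blast
    then have "V {0..0 + T} \<gamma>" by (simp add: V_def)
    then show "\<A> \<noteq> {}" by (auto simp: \<A>_def)
  next
    fix \<C> assume ne: "\<C> \<noteq> {}" and chain: "subset.chain \<A> \<C>"
    have \<C>: "G \<in> \<A>" if "G \<in> \<C>" for G using that chain by (auto simp: subset_chain_def)
    have cmp: "G \<subseteq> H \<or> H \<subseteq> G" if "G \<in> \<C>" "H \<in> \<C>" for G H
      using that chain by (auto simp: subset_chain_def)
    define J where "J = fst ` \<Union>\<C>"
    define \<delta> where "\<delta> s = (SOME m. (s, m) \<in> \<Union>\<C>)" for s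
    have unique: "m = m'" if sm: "(s, m) \<in> \<Union>\<C>" "(s, m') \<in> \<Union>\<C>" for s m m'
    proof -
      obtain G H where GH: "G \<in> \<C>" "H \<in> \<C>" "(s, m) \<in> G" "(s, m') \<in> H" using sm by blast
      obtain K where K: "K \<in> \<C>" "(s, m) \<in> K" "(s, m') \<in> K" using cmp[OF GH(1,2)] GH by blast
      then obtain I \<gamma> where "K = graph I \<gamma>" using \<C>[OF K(1)] unfolding \<A>_def by blast
      then show ?thesis using K by (simp add: mem_graph)
    qed
    have \<delta>: "(s, \<delta> s) \<in> \<Union>\<C>" if "s \<in> J" for s
    proof -
      have "\<exists>m. (s, m) \<in> \<Union>\<C>" using that by (force simp: J_def)
      then show ?thesis unfolding \<delta>_def by (rule someI_ex)
    qed
    have curve: "\<exists>I \<gamma>. graph I \<gamma> \<in> \<C> \<and> V I \<gamma> \<and> a \<in> I \<and> b \<in> I" if ab: "a \<in> J" "b \<in> J" for a b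
    proof -
      obtain G H where GH: "G \<in> \<C>" "H \<in> \<C>" "(a, \<delta> a) \<in> G" "(b, \<delta> b) \<in> H"
        using \<delta>[OF ab(1)] \<delta>[OF ab(2)] by blast
      obtain K where K: "K \<in> \<C>" "(a, \<delta> a) \<in> K" "(b, \<delta> b) \<in> K" using cmp[OF GH(1,2)] GH by blast
      obtain I \<gamma> where I: "K = graph I \<gamma>" "V I \<gamma>" using \<C>[OF K(1)] unfolding \<A>_def by blast
      then show ?thesis using K by (intro exI[of _ I] exI[of _ \<gamma>]) (simp add: mem_graph)
    qed
    have agree: "I \<subseteq> J" "\<And>s. s \<in> I \<Longrightarrow> \<delta> s = \<gamma> s" if "graph I \<gamma> \<in> \<C>" for I \<gamma>
    proof -
      have *: "(s, \<gamma> s) \<in> \<Union>\<C>" if "s \<in> I" for s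
        using that \<open>graph I \<gamma> \<in> \<C>\<close> by (auto simp: graph_def)
      then show "I \<subseteq> J" by (force simp: J_def)
      then show "\<delta> s = \<gamma> s" if "s \<in> I" for s using unique[OF \<delta> *] that by blast
    qed
    have graph_\<delta>: "\<Union>\<C> = graph J \<delta>"
    proof
      show "\<Union>\<C> \<subseteq> graph J \<delta>"
      proof
        fix x assume x: "x \<in> \<Union>\<C>"
        obtain s m where sm: "x = (s, m)" by (cases x)
        then have "s \<in> J" using x by (force simp: J_def)
        then show "x \<in> graph J \<delta>" using unique[OF \<delta>, of s m] x sm by (simp add: mem_graph)
      qed
      show "graph J \<delta> \<subseteq> \<Union>\<C>" using \<delta> by (auto simp: graph_def)
    qed
    have interval: "{a..b} \<subseteq> I" if "V I \<gamma>" "a \<in> I" "b \<in> I" for I \<gamma> a b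
      using that integral_curveD(1)[of I \<gamma>] unfolding V_def is_interval_1 by (meson atLeastAtMost_iff subsetI)
    have J_interval: "is_interval J"
      unfolding is_interval_1
    proof (intro ballI allI impI)
      fix a b x assume ab: "a \<in> J" "b \<in> J" and x: "a \<le> x \<and> x \<le> b"
      obtain I \<gamma> where I: "graph I \<gamma> \<in> \<C>" "V I \<gamma>" "a \<in> I" "b \<in> I" using curve[OF ab] by blast
      then show "x \<in> J" using interval[OF I(2,3,4)] agree(1)[OF I(1)] x by auto
    qed
    obtain G where "G \<in> \<C>" using ne by blast
    then obtain I0 \<gamma>0 where I0: "graph I0 \<gamma>0 \<in> \<C>" "V I0 \<gamma>0" using \<C> unfolding \<A>_def by blast
    have "V J \<delta>" unfolding V_def
    proof (intro conjI)
      show "0 \<in> J" "\<delta> 0 = m0" using I0 agree[OF I0(1)] unfolding V_def by auto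
      show "\<delta> ` J \<subseteq> F"
      proof safe
        fix s assume "s \<in> J"
        then obtain I \<gamma> where I: "graph I \<gamma> \<in> \<C>" "V I \<gamma>" "s \<in> I" using curve by blast
        then show "\<delta> s \<in> F" using agree(2)[OF I(1,3)] unfolding V_def by auto
      qed
      show "integral_curve A U X J \<delta>"
      proof (rule integral_curve_locally[OF J_interval])
        show "J \<noteq> {}" using \<open>0 \<in> J\<close> by blast
        fix s assume s: "s \<in> J"
        \<comment> \<open>\<open>a\<close> and \<open>b\<close> enclose \<open>s\<close>, strictly
          on each side on which \<open>J\<close> has points. One member of the chain that covers
          both then covers a neighborhood of \<open>s\<close> in \<open>J\<close>, even if
          \<open>s\<close> is an endpoint of \<open>J\<close>; on such a side the value 1 in
          \<open>e\<close> is arbitrary.\<close>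
        obtain a where a: "a \<in> J" "a \<le> s" "(\<exists>t\<in>J. t < s) \<Longrightarrow> a < s" using s by (meson less_imp_le order_refl)
        obtain b where b: "b \<in> J" "s \<le> b" "(\<exists>t\<in>J. s < t) \<Longrightarrow> s < b" using s by (meson less_imp_le order_refl)
        obtain I \<gamma> where I: "graph I \<gamma> \<in> \<C>" "V I \<gamma>" "a \<in> I" "b \<in> I" using curve[OF a(1) b(1)] by blast
        define e where "e = min (if a < s then s - a else 1) (if s < b then b - s else 1)"
        have "e > 0" by (simp add: e_def)
        moreover have "J \<inter> ball s e \<subseteq> {a..b}"
        proof
          fix t assume t: "t \<in> J \<inter> ball s e"
          then have "\<bar>s - t\<bar> < e" "t \<in> J" by (auto simp: dist_real_def)
          moreover have "a < s" "e \<le> s - a" if "t < s" using a(3) \<open>t \<in> J\<close> that by (auto simp: e_def)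
          moreover have "s < b" "e \<le> b - s" if "s < t" using b(3) \<open>t \<in> J\<close> that by (auto simp: e_def)
          ultimately show "t \<in> {a..b}" using a(2) b(2) by (cases t s rule: linorder_cases) auto
        qed
        then have sub: "J \<inter> ball s e \<subseteq> I" using interval[OF I(2,3,4)] by blast
        moreover have "\<forall>t\<in>J \<inter> ball s e. \<gamma> t = \<delta> t" using sub agree(2)[OF I(1)] by auto
        ultimately show "\<exists>I \<gamma> e. integral_curve A U X I \<gamma> \<and> e > 0 \<and> J \<inter> ball s e \<subseteq> I \<and>
            (\<forall>t\<in>J \<inter> ball s e. \<gamma> t = \<delta> t)"
          using I(2) unfolding V_def by blast
      qed
    qed
    then show "\<Union>\<C> \<in> \<A>" unfolding graph_\<delta> \<A>_def by blast
  qed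
  then obtain M where M: "M \<in> \<A>" "\<And>G. G \<in> \<A> \<Longrightarrow> M \<subseteq> G \<Longrightarrow> G = M" by blast
  obtain I \<gamma> where I: "V I \<gamma>" "M = graph I \<gamma>" using M(1) unfolding \<A>_def by blast
  have max: "J = I" if J: "V J \<delta>" "I \<subseteq> J" "\<And>t. t \<in> I \<Longrightarrow> \<delta> t = \<gamma> t" for J \<delta>
  proof -
    have "graph I \<gamma> \<subseteq> graph J \<delta>" using J(2,3) by (auto simp: mem_graph)
    moreover have "graph J \<delta> \<in> \<A>" using J(1) by (auto simp: \<A>_def)
    ultimately have "graph J \<delta> = graph I \<gamma>" using M(2) I(2) by blast
    moreover have "fst ` graph K \<zeta> = K" for K \<zeta> by (force simp: graph_def)
    ultimately show ?thesis by metis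
  qed
  have I': "0 \<in> I" "\<gamma> 0 = m0" "integral_curve A U X I \<gamma>" "\<gamma> ` I \<subseteq> F" using I(1) by (auto simp: V_def)
  note ID = integral_curveD[OF I'(3)]
  \<comment> \<open>By maximality, a curve in \<open>F\<close> attached at an endpoint of
    \<open>I\<close> brings no new times. The glued curve gives priority to \<open>\<gamma>\<close>,
    which does no harm: the two intervals meet only at \<open>s\<close>, where the curves
    agree.\<close>
  have no_glue: "E \<subseteq> I" if E: "integral_curve A U X E \<eta>" "\<eta> ` E \<subseteq> F" "s \<in> I" "s \<in> E" "\<eta> s = \<gamma> s"
    and sides: "I \<subseteq> {..s} \<and> E \<subseteq> {s..} \<or> E \<subseteq> {..s} \<and> I \<subseteq> {s..}" for E \<eta> s
  proof -
    define \<zeta> where "\<zeta> t = (if t \<in> I then \<gamma> t else \<eta> t)" for t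
    have \<zeta>E: "\<zeta> t = \<eta> t" if "t \<in> E" for t
    proof (cases "t \<in> I")
      case True
      then have "t = s" using sides that by (force simp: subset_eq intro: antisym)
      then show ?thesis using E by (simp add: \<zeta>_def)
    qed (simp add: \<zeta>_def)
    have "integral_curve A U X I \<zeta>"
      using integral_curve_subset[OF I'(3) ID(1,2) order_refl] by (simp add: \<zeta>_def)
    moreover have "integral_curve A U X E \<zeta>"
      using integral_curve_subset[OF E(1) integral_curveD(1,2)[OF E(1)] order_refl \<zeta>E] .
    ultimately have "integral_curve A U X (I \<union> E) \<zeta>"
      using sides integral_curve_Un[of I \<zeta> E s] integral_curve_Un[of E \<zeta> I s] E(3,4) by (auto simp: Un_commute)
    moreover have "\<zeta> ` (I \<union> E) \<subseteq> F" using E(2) I'(4) \<zeta>E by (auto simp: \<zeta>_def)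
    ultimately have "V (I \<union> E) \<zeta>" using I' by (auto simp: V_def \<zeta>_def)
    then have "I \<union> E = I" by (rule max) (auto simp: \<zeta>_def)
    then show ?thesis by blast
  qed
  have False if ext: "integral_curve A U X J \<delta>" "I \<subset> J" "\<forall>t\<in>I. \<delta> t = \<gamma> t" for J \<delta>
  proof -
    note JD = integral_curveD[OF ext(1)]
    have endpoint: "s \<in> I" if s: "s \<in> J" "s \<in> closure I" "is_interval (insert s I)" for s
    proof -
      have "\<delta> s \<in> F"
      proof (rule ccontr)
        assume "\<delta> s \<notin> F"
        then have "\<delta> s \<in> U - F" using JD(4) s(1) by auto
        moreover have "\<exists>T. open T \<and> T \<inter> J = \<delta> -` (U - F) \<inter> J"
          using JD(3) F(2) unfolding continuous_on_open_invariant by blast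
        ultimately obtain T where T: "open T" "T \<inter> J = \<delta> -` (U - F) \<inter> J" "s \<in> T"
          using s(1) by blast
        then have "T \<inter> I \<noteq> {}" using open_Int_closure_eq_empty[OF T(1), of I] s(2) T(3) by blast
        then obtain t where "t \<in> T" "t \<in> I" by blast
        then show False using T(2) ext(2,3) I'(4) by force
      qed
      moreover have "integral_curve A U X (insert s I) \<delta>"
        using integral_curve_subset[OF ext(1) s(3)] s(1) ext(2) by auto
      ultimately have "V (insert s I) \<delta>" using I' ext(3) unfolding V_def by force
      then have "insert s I = I" by (rule max) (use ext(3) in auto)
      then show ?thesis by blast
    qed
    obtain b where b: "b \<in> J" "b \<notin> I" using ext(2) by blast
    have cases: "(\<forall>t\<in>I. t < b) \<or> (\<forall>t\<in>I. b < t)"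
    proof (rule ccontr)
      assume "\<not> ?thesis"
      then obtain t u where "t \<in> I" "u \<in> I" "b \<le> t" "u \<le> b" by (metis not_le)
      then show False using ID(1) b(2) unfolding is_interval_1 by blast
    qed
    then show False
    proof
      assume above: "\<forall>t\<in>I. t < b"
      define s where "s = Sup I"
      have bdd: "bdd_above I" using above by (meson bdd_aboveI less_imp_le)
      have le: "t \<le> s" if "t \<in> I" for t unfolding s_def using cSup_upper[OF that bdd] .
      have sb: "s \<le> b" unfolding s_def using above ID(2) by (intro cSup_least) (auto intro: less_imp_le)
      have "s \<in> J" using JD(1) b(1) I'(1) ext(2) le[OF I'(1)] sb unfolding is_interval_1 by blast
      moreover have "s \<in> closure I" unfolding s_def by (rule closure_contains_Sup[OF ID(2) bdd])
      moreover have "is_interval (insert s I)" unfolding is_interval_1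
      proof (intro ballI allI impI)
        fix x y z assume xy: "x \<in> insert s I" "y \<in> insert s I" "x \<le> z \<and> z \<le> y"
        show "z \<in> insert s I"
        proof (cases "z < s \<and> x \<noteq> s")
          case True
          then obtain t where "t \<in> I" "z < t" unfolding s_def using less_cSup_iff[OF ID(2) bdd] by blast
          then show ?thesis using True xy ID(1) unfolding is_interval_1 by (metis insertE insertI2 less_imp_le)
        next
          case False
          then have "z = s" using xy le by force
          then show ?thesis by simp
        qed
      qed
      ultimately have sI: "s \<in> I" by (rule endpoint)
      then have "\<gamma> s \<in> F" using I'(4) by auto
      then obtain T \<eta> where "T > 0" "\<eta> s = \<gamma> s" "integral_curve A U X {s..s + T} \<eta>" "\<eta> ` {s..s + T} \<subseteq> F"
        using fwd[of "\<gamma> s" s] by blast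
      then have "{s..s + T} \<subseteq> I" using sI le by (intro no_glue[of _ \<eta> s]) auto
      then show False using le[of "s + T"] \<open>T > 0\<close> by (auto simp: subset_eq)
    next
      assume below: "\<forall>t\<in>I. b < t"
      define s where "s = Inf I"
      have bdd: "bdd_below I" using below by (meson bdd_belowI less_imp_le)
      have le: "s \<le> t" if "t \<in> I" for t unfolding s_def using cInf_lower[OF that bdd] .
      have sb: "b \<le> s" unfolding s_def using below ID(2) by (intro cInf_greatest) (auto intro: less_imp_le)
      have "s \<in> J" using JD(1) b(1) I'(1) ext(2) le[OF I'(1)] sb unfolding is_interval_1 by blast
      moreover have "s \<in> closure I" unfolding s_def by (rule closure_contains_Inf[OF ID(2) bdd])
      moreover have "is_interval (insert s I)" unfolding is_interval_1
      proof (intro ballI allI impI)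
        fix x y z assume xy: "x \<in> insert s I" "y \<in> insert s I" "x \<le> z \<and> z \<le> y"
        show "z \<in> insert s I"
        proof (cases "s < z \<and> y \<noteq> s")
          case True
          then obtain t where "t \<in> I" "t < z" unfolding s_def using cInf_less_iff[OF ID(2) bdd] by blast
          then show ?thesis using True xy ID(1) unfolding is_interval_1 by (metis insertE insertI2 less_imp_le)
        next
          case False
          then have "z = s" using xy le by force
          then show ?thesis by simp
        qed
      qed
      ultimately have sI: "s \<in> I" by (rule endpoint)
      then have "\<gamma> s \<in> F" using I'(4) by auto
      then obtain T \<eta> where "T > 0" "\<eta> s = \<gamma> s" "integral_curve A U X {s - T..s} \<eta>" "\<eta> ` {s - T..s} \<subseteq> F"
        using bwd[of "\<gamma> s" s] by blast
      then have "{s - T..s} \<subseteq> I" using sI le by (intro no_glue[of _ \<eta> s]) auto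
      then show False using le[of "s - T"] \<open>T > 0\<close> by (auto simp: subset_eq)
    qed
  qed
  then have "maximal_integral_curve A U X I \<gamma>"
    using I'(3) unfolding maximal_integral_curve_def by blast
  then show thesis using that I' by blast
qed

end

section \<open>Integral curves inside the support\<close>

context invariant_measure
begin

lemma invariant_measure_uminus: "invariant_measure A U (\<lambda>m c. - X m c) \<mu>"
proof -
  interpret neg: continuous_vf A U "\<lambda>m c. - X m c" by (rule continuous_vf_uminus)
  show ?thesis
  proof
    show "nonneg_density_measure U \<mu>" by (rule density)
    show "transpose_annihilates A U (\<lambda>m c. - X m c) \<mu>"
      unfolding transpose_annihilates_def
    proof (intro allI impI)
      fix f assume f: "test_function A U f"
      have "(\<integral>m. derivative_along A (\<lambda>m c. - X m c) f m \<partial>\<mu>) = (\<integral>m. - derivative_along A X f m \<partial>\<mu>)"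
        using derivative_along_uminus[OF f] by (intro Bochner_Integration.integral_cong refl) (simp add: space_\<mu>)
      then show "(\<integral>m. derivative_along A (\<lambda>m c. - X m c) f m \<partial>\<mu>) = 0"
        using invariant f by (simp add: transpose_annihilates_def)
    qed
  qed
qed

lemma supp_subset: "measure_supp U \<mu> \<subseteq> U"
  by (auto simp: measure_supp_def)

lemma open_compl_supp: "open (U - measure_supp U \<mu>)"
proof -
  have "U - measure_supp U \<mu> = \<Union>{V. open V \<and> V \<subseteq> U \<and> emeasure \<mu> V = 0}"
    by (auto simp: measure_supp_def)
  then show ?thesis by auto
qed

text \<open>Only nonnegative times are treated. Applied to the field \<open>- X\<close>, which
  satisfies the same hypotheses, the lemma also serves for negative times.\<close>

lemma curve_in_supp:
  assumes "m \<in> measure_supp U \<mu>"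
  obtains c T x where "c \<in> A" "T > 0" "param c (x 0) = m"
    "\<And>t::real. x t \<in> coords c ` (measure_supp U \<mu> \<inter> chart_dom c)"
    "\<And>t. t \<in> {0..T} \<Longrightarrow> (x has_vector_derivative X (param c (x t)) c) (at t within {0..T})"
proof -
  obtain c where c: "c \<in> A" "m \<in> chart_dom c" by (rule obtain_chart)
  note cc = chart[OF c(1)]
  define S where "S = coords c ` (measure_supp U \<mu> \<inter> chart_dom c)"
  define a where "a = coords c m"
  have "open (coords c ` (U \<inter> chart_dom c))"
    using open_U open_chart_dom[OF c(1)] by (intro chart_open_image[OF cc]) auto
  moreover have "a \<in> coords c ` (U \<inter> chart_dom c)" using assms c supp_subset by (auto simp: a_def)
  ultimately obtain R where R: "R > 0" "cball a R \<subseteq> coords c ` (U \<inter> chart_dom c)"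
    by (meson open_contains_cball)
  \<comment> \<open>Half the radius, since \<open>supp_step\<close> wants twice the radius of its
    ball to fit into the chart.\<close>
  define r where "r = R / 2"
  have r: "r > 0" "cball a (2 * r) \<subseteq> coords c ` (U \<inter> chart_dom c)" using R by (auto simp: r_def)
  have ar: "cball a r \<subseteq> coords c ` (U \<inter> chart_dom c)"
    using r subset_cball[of r "2 * r" a] by force
  \<comment> \<open>The support is closed only relative to \<open>U\<close>. That is enough here,
    because the ball lies in the image of \<open>U\<close>.\<close>
  have closed: "closed (S \<inter> cball a r)"
  proof -
    define W where "W = coords c ` ((U - measure_supp U \<mu>) \<inter> chart_dom c)"
    have "open W" unfolding W_def
      using open_compl_supp open_chart_dom[OF c(1)] by (intro chart_open_image[OF cc]) auto
    moreover have "S \<inter> cball a r = cball a r - W"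
    proof (intro set_eqI iffI)
      fix z assume "z \<in> S \<inter> cball a r"
      then show "z \<in> cball a r - W"
        using chart_inverse(1)[OF cc] unfolding S_def W_def by (auto dest: arg_cong[of _ _ "param c"])
    next
      fix z assume z: "z \<in> cball a r - W"
      then obtain m' where "m' \<in> U \<inter> chart_dom c" "z = coords c m'" using ar by blast
      then show "z \<in> S \<inter> cball a r" using z by (auto simp: S_def W_def)
    qed
    ultimately show ?thesis by (simp add: closed_Diff)
  qed
  have cont: "continuous_on (cball a r) (\<lambda>x. X (param c x) c)"
  proof (rule continuous_on_compose2[OF continuous_X[OF c(1)]])
    show "continuous_on (cball a r) (param c)"
      by (rule continuous_on_subset[OF chart_continuous(2)[OF cc]]) (use ar in auto)
    show "param c ` cball a r \<subseteq> U \<inter> chart_dom c"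
    proof
      fix m' assume "m' \<in> param c ` cball a r"
      then obtain m'' where "m'' \<in> U \<inter> chart_dom c" "m' = param c (coords c m'')" using ar by blast
      then show "m' \<in> U \<inter> chart_dom c" using chart_inverse(1)[OF cc] by simp
    qed
  qed
  have aS: "a \<in> S" using assms c by (auto simp: a_def S_def)
  obtain T x where "T > 0" "x 0 = a" "\<And>t. x t \<in> S \<inter> cball a r"
    "\<And>t. t \<in> {0..T} \<Longrightarrow> (x has_vector_derivative X (param c (x t)) c) (at t within {0..T})"
    using viable_curve[OF aS r(1) closed cont supp_step[OF c(1) r, folded S_def]] by blast
  then show thesis
    using that[of c T x] c chart_inverse(1)[OF cc c(2)] by (auto simp: S_def a_def)
qed

section \<open>Short curves in the support and the conclusion\<close>

lemma integral_curve_in_supp_forward: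
  assumes "m \<in> measure_supp U \<mu>"
  shows "\<exists>T>0. \<exists>\<gamma>. \<gamma> s = m \<and> integral_curve A U X {s..s + T} \<gamma> \<and> \<gamma> ` {s..s + T} \<subseteq> measure_supp U \<mu>"
proof -
  obtain c T x where c: "c \<in> A" "T > 0" "param c (x 0) = m"
    and x: "\<And>t::real. x t \<in> coords c ` (measure_supp U \<mu> \<inter> chart_dom c)"
    and der: "\<And>t. t \<in> {0..T} \<Longrightarrow> (x has_vector_derivative X (param c (x t)) c) (at t within {0..T})"
    by (rule curve_in_supp[OF assms]) blast
  \<comment> \<open>The equation is autonomous, so the curve may start at any time \<open>s\<close>;
    gluing at the endpoint of a given interval requires this.\<close>
  have "integral_curve A U X {s..s + T} (\<lambda>t. param c (x (t - s)))"
  proof (rule integral_curve_in_chart[OF c(1)])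
    fix t assume t: "t \<in> {s..s + T}"
    show "x (t - s) \<in> coords c ` (U \<inter> chart_dom c)" using x[of "t - s"] supp_subset by blast
    have "((\<lambda>t. t - s) has_vector_derivative 1) (at t within {s..s + T})"
      by (auto intro!: derivative_eq_intros)
    moreover have "(x has_vector_derivative X (param c (x (t - s))) c) (at (t - s) within (\<lambda>t. t - s) ` {s..s + T})"
      by (rule has_vector_derivative_within_subset[OF der]) (use t in auto)
    ultimately show "((\<lambda>t. x (t - s)) has_vector_derivative X (param c (x (t - s))) c) (at t within {s..s + T})"
      using vector_diff_chain_within by (fastforce simp: o_def)
  qed (use c in auto)
  moreover have "param c (x t) \<in> measure_supp U \<mu>" for t
    using x[of t] chart_inverse(1)[OF chart[OF c(1)]] by auto
  ultimately show ?thesis using c(2,3) by (intro exI[of _ T] conjI exI[of _ "\<lambda>t. param c (x (t - s))"]) auto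
qed

lemma integral_curve_in_supp_backward:
  assumes "m \<in> measure_supp U \<mu>"
  shows "\<exists>T>0. \<exists>\<gamma>. \<gamma> s = m \<and> integral_curve A U X {s - T..s} \<gamma> \<and> \<gamma> ` {s - T..s} \<subseteq> measure_supp U \<mu>"
proof -
  interpret neg: invariant_measure A U "\<lambda>m c. - X m c" \<mu> by (rule invariant_measure_uminus)
  obtain c T x where c: "c \<in> A" "T > 0" "param c (x 0) = m"
    and x: "\<And>t::real. x t \<in> coords c ` (measure_supp U \<mu> \<inter> chart_dom c)"
    and der: "\<And>t. t \<in> {0..T} \<Longrightarrow> (x has_vector_derivative - X (param c (x t)) c) (at t within {0..T})"
    by (rule neg.curve_in_supp[OF assms]) blast
  \<comment> \<open>Reversing time turns a curve of \<open>- X\<close> that starts at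
    \<open>m\<close> into a curve of \<open>X\<close> that reaches \<open>m\<close> at time
    \<open>s\<close>.\<close>
  have "integral_curve A U X {s - T..s} (\<lambda>t. param c (x (s - t)))"
  proof (rule integral_curve_in_chart[OF c(1)])
    fix t assume t: "t \<in> {s - T..s}"
    show "x (s - t) \<in> coords c ` (U \<inter> chart_dom c)" using x[of "s - t"] supp_subset by blast
    have "((\<lambda>t. s - t) has_vector_derivative - 1) (at t within {s - T..s})"
      by (auto intro!: derivative_eq_intros)
    moreover have "(x has_vector_derivative - X (param c (x (s - t))) c) (at (s - t) within (\<lambda>t. s - t) ` {s - T..s})"
      by (rule has_vector_derivative_within_subset[OF der]) (use t in auto)
    ultimately show "((\<lambda>t. x (s - t)) has_vector_derivative X (param c (x (s - t))) c) (at t within {s - T..s})"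
      using vector_diff_chain_within by (fastforce simp: o_def)
  qed (use c in auto)
  moreover have "param c (x t) \<in> measure_supp U \<mu>" for t
    using x[of t] chart_inverse(1)[OF chart[OF c(1)]] by auto
  ultimately show ?thesis using c(2,3) by (intro exI[of _ T] conjI exI[of _ "\<lambda>t. param c (x (s - t))"]) auto
qed

lemma maximal_integral_curve_in_supp:
  assumes "m0 \<in> measure_supp U \<mu>"
  shows "\<exists>I \<gamma>. 0 \<in> I \<and> maximal_integral_curve A U X I \<gamma> \<and> \<gamma> 0 = m0 \<and> \<gamma> ` I \<subseteq> measure_supp U \<mu>"
  using maximal_integral_curve_exists[OF supp_subset open_compl_supp integral_curve_in_supp_forward
      integral_curve_in_supp_backward assms] by metis

end

theorem theorem1p9:
  fixes A :: "('a::{t2_space,second_countable_topology}, 'e::euclidean_space) chart set"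
    and U :: "'a set"
    and X :: "'a \<Rightarrow> ('a, 'e) chart \<Rightarrow> 'e"
    and \<mu> :: "'a measure"
  assumes "smooth_atlas A"
    and "open U"
    and "continuous_vector_field A U X"
    and "nonneg_density_measure U \<mu>"
    and "transpose_annihilates A U X \<mu>"
  shows "(\<exists>\<C>. (\<forall>(I, \<gamma>)\<in>\<C>. maximal_integral_curve A U X I \<gamma>) \<and>
              measure_supp U \<mu> = (\<Union>(I, \<gamma>)\<in>\<C>. \<gamma> ` I)) \<and>
         (\<forall>m0\<in>measure_supp U \<mu>. \<exists>I \<gamma>. 0 \<in> I \<and> maximal_integral_curve A U X I \<gamma> \<and>
              \<gamma> 0 = m0 \<and> \<gamma> ` I \<subseteq> measure_supp U \<mu>)"
proof -
  interpret invariant_measure A U X \<mu>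
    using assms by unfold_locales
  \<comment> \<open>Collecting all maximal curves that stay in the support makes one inclusion
    immediate; the other needs one such curve through each point.\<close>
  let ?\<C> = "{(I, \<gamma>). maximal_integral_curve A U X I \<gamma> \<and> \<gamma> ` I \<subseteq> measure_supp U \<mu>}"
  have "measure_supp U \<mu> = (\<Union>(I, \<gamma>)\<in>?\<C>. \<gamma> ` I)"
  proof
    show "measure_supp U \<mu> \<subseteq> (\<Union>(I, \<gamma>)\<in>?\<C>. \<gamma> ` I)"
    proof
      fix m assume "m \<in> measure_supp U \<mu>"
      then obtain I \<gamma> where "0 \<in> I" "maximal_integral_curve A U X I \<gamma>" "\<gamma> 0 = m" "\<gamma> ` I \<subseteq> measure_supp U \<mu>"
        using maximal_integral_curve_in_supp by blast
      then show "m \<in> (\<Union>(I, \<gamma>)\<in>?\<C>. \<gamma> ` I)" by (intro UN_I[of "(I, \<gamma>)"]) auto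
    qed
  qed auto
  then show ?thesis
    using maximal_integral_curve_in_supp by (intro conjI exI[of _ ?\<C>]) auto
qed

end
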